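(* Consider the labeled $r$-block model described in the context with constant $\omega$. Define \[\tau=\frac{1}{r(a+b)}\sum_{\ell\in\mathcal{L}}|a\mu(\ell)-b\nu(\ell)|,\qquad \omega_0=1/\tau.\] If $\omega<\omega_0$, then for two randomly chosen nodes $\rho$ and $v$, for all $x,y\in\{1,\dots,r\}$, \[\mathbb{P}(\sigma_\rho=x\mid G,\sigma_v=y)\to\frac1r\] asymptotically almost surely (i.e. with probability tending to one as $n\to\infty$, the conditional probability is $(1+o(1))/r$).
   Context: Model: $n$ nodes with i.i.d. attributes $\sigma_i$ uniform on $\mathcal{X}=\{1,\dots,r\}$, $r\ge2$. For positive constants $a,b$, each pair $i,j$ independently has an edge with probability $\frac{a}{a+b}$ if $\sigma_i=\sigma_j$ and $\frac{b}{a+b}$ otherwise; each edge is independently labeled from a finite label set $\mathcal{L}$ according to a probability measure $\mu$ if $\sigma_i=\sigma_j$ and $\nu$ otherwise ($\mu\ne\nu$); each labeled edge is independently retained with probability $\omega/n$, with $\omega>0$ a constant. $G$ denotes the observed labeled graph (retained edges with their labels). *)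

theory Defs
  imports "HOL-Probability.Probability"
begin

text \<open>Observation of a single pair of nodes: edge present with probability
  a/(a+b) (same attribute) or b/(a+b) (different attributes), label drawn from
  mu resp. nu, edge retained with probability omega/n (capped at 1).
  None means no observed edge, Some l an observed edge with label l.\<close>
definition edge_obs ::
  "real \<Rightarrow> real \<Rightarrow> real \<Rightarrow> nat \<Rightarrow> 'l pmf \<Rightarrow> 'l pmf \<Rightarrow> bool \<Rightarrow> 'l option pmf" where
  "edge_obs a b \<omega> n \<mu> \<nu> same =
     bind_pmf (bernoulli_pmf (if same then a / (a + b) else b / (a + b))) (\<lambda>e.
     bind_pmf (if same then \<mu> else \<nu>) (\<lambda>l.
     bind_pmf (bernoulli_pmf (min 1 (\<omega> / real n))) (\<lambda>k.
     return_pmf (if e \<and> k then Some l else None))))"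

definition node_pairs :: "nat \<Rightarrow> (nat \<times> nat) set" where
  "node_pairs n = {(i, j). i < j \<and> j < n}"

definition lsbm ::
  "nat \<Rightarrow> real \<Rightarrow> real \<Rightarrow> real \<Rightarrow> 'l pmf \<Rightarrow> 'l pmf \<Rightarrow> nat
   \<Rightarrow> ((nat \<Rightarrow> nat) \<times> (nat \<times> nat \<Rightarrow> 'l option)) pmf" where
  "lsbm r a b \<omega> \<mu> \<nu> n =
     bind_pmf (Pi_pmf {..<n} 0 (\<lambda>_. pmf_of_set {1..r})) (\<lambda>\<sigma>.
       map_pmf (\<lambda>G. (\<sigma>, G))
         (Pi_pmf (node_pairs n) None (\<lambda>(i, j). edge_obs a b \<omega> n \<mu> \<nu> (\<sigma> i = \<sigma> j))))"

definition cond_prob ::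
  "nat \<Rightarrow> real \<Rightarrow> real \<Rightarrow> real \<Rightarrow> 'l pmf \<Rightarrow> 'l pmf \<Rightarrow> nat
   \<Rightarrow> nat \<Rightarrow> nat \<Rightarrow> nat \<Rightarrow> nat \<Rightarrow> (nat \<times> nat \<Rightarrow> 'l option) \<Rightarrow> real" where
  "cond_prob r a b \<omega> \<mu> \<nu> n \<rho> v x y g =
     measure_pmf.prob (lsbm r a b \<omega> \<mu> \<nu> n) {(\<sigma>, G). \<sigma> \<rho> = x \<and> \<sigma> v = y \<and> G = g}
     / measure_pmf.prob (lsbm r a b \<omega> \<mu> \<nu> n) {(\<sigma>, G). \<sigma> v = y \<and> G = g}"

definition tau :: "nat \<Rightarrow> real \<Rightarrow> real \<Rightarrow> 'l::finite pmf \<Rightarrow> 'l pmf \<Rightarrow> real" where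
  "tau r a b \<mu> \<nu> = (\<Sum>l\<in>UNIV. \<bar>a * pmf \<mu> l - b * pmf \<nu> l\<bar>) / (real r * (a + b))"

end

theory Submission
  imports Defs
begin

text \<open>
  Let \<open>J(i; T, S)\<close> be the mutual information between the colour of \<open>i\<close> and the graph on \<open>T\<close> together
  with the colours on \<open>S\<close>. Attach a new vertex \<open>\<rho>\<close> to \<open>T\<close> and reveal its edges one at a time. By the
  chain rule, the edge to \<open>w\<close> adds at most the expectation of \<open>edge_kl\<close> at the posterior probability
  that \<open>w\<close> has the colour of \<open>\<rho>\<close>. If that posterior is replaced by the one before \<open>\<rho>\<close> was attached, which
  is independent of the uniform colour of \<open>\<rho>\<close>, convexity bounds this by \<open>(\<omega>\<tau>/n) J(w; T, S)\<close>; the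
  absence of an edge contributes only \<open>O(1/n\<^sup>2)\<close>. Hence \<open>J(\<rho>; T + \<rho>, S) \<le> \<omega>\<tau> J(w; T, S)\<close> up to an error
  controlled by the increase of the squared \<open>L\<^sup>2\<close> norm of the posterior of \<open>w\<close> when \<open>\<rho>\<close>, with its colour and
  edges, is revealed. These norms are bounded and monotone, so after adding at most \<open>m\<close> revealed
  vertices one increase is at most \<open>1/m\<close>. As \<open>J(\<rho>; T + \<rho>, S) = J(w; T + \<rho>, S) \<ge> J(w; T, S)\<close> by
  exchangeability and \<open>\<omega>\<tau> < 1\<close>, the information is small there, and by monotonicity also with
  a single revealed vertex. No comparison with a branching tree is needed.
\<close>

section \<open>Convexity inequalities for relative entropy\<close>

text \<open>The factor \<omega>\<tau> comes from sorting the labels by the sign of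
  \<open>pmf P y - pmf Q y\<close>. A label favouring equal colours sees the posterior of the
  neighbour directly; one favouring different colours sees it through the channel to a uniformly
  chosen other colour. That channel contracts relative entropy by \<open>r - 1\<close>, exactly the
  extra weight with which such labels enter, so both kinds obey the same bound and their weights add
  up to the absolute values in \<tau>. Two obstacles shape the rest. While the edges at \<rho> are
  being revealed, the posterior of the next neighbour already depends on the colour of \<rho>, so
  that colour cannot be averaged out; and x ln x has infinite slope at 0, so the discrepancy cannot
  be paid for by a Lipschitz bound. A modulus \<eta> + C (p - q)^2 does pay for it, because the mean
  square of a posterior increment is a difference of energies. As \<eta>, C and m are chosen before
  n, revealed vertices and absent edges cost only O(1/n) in total.\<close>

definition psi :: "real \<Rightarrow> real" where
  "psi t = t * ln t - t + 1"

lemma mult_ln_ratio_ge: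
  fixes s t :: real
  assumes "s > 0" "t \<ge> 0"
  shows "t * ln t - t * ln s \<ge> t - s"
proof (cases "t = 0")
  case False
  then have t: "t > 0" using assms by simp
  have "ln (s / t) \<le> s / t - 1" using assms t by (intro ln_le_minus_one) simp
  then have "t * ln (s / t) \<le> t * (s / t - 1)" using t by (intro mult_left_mono) auto
  then show ?thesis using t assms by (simp add: ln_div algebra_simps)
qed (use assms in simp)

lemma psi_tangent:
  assumes "s > 0" "t \<ge> 0"
  shows "psi s + ln s * (t - s) \<le> psi t"
  using mult_ln_ratio_ge[OF assms] by (simp add: psi_def algebra_simps)

lemma psi_one [simp]: "psi 1 = 0"
  by (simp add: psi_def)

text \<open>Convexity together with \<open>psi 1 = 0\<close>: the tangent at the mixture point is
  averaged over 1 and \<open>t\<close>. The gained factor \<open>c\<close> later becomes the weight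
  of an edge label. A vanishing mixture point has no tangent, but it forces \<open>c = 1\<close> and
  \<open>t = 0\<close>.\<close>

lemma psi_mix_one_le:
  assumes "0 \<le> c" "c \<le> 1" "t \<ge> 0"
  shows "psi ((1 - c) + c * t) \<le> c * psi t"
proof (cases "(1 - c) + c * t = 0")
  case True
  have "1 - c = 0" "c * t = 0" using True assms by (auto simp: add_nonneg_eq_0_iff)
  then show ?thesis by simp
next
  case False
  define s where "s = (1 - c) + c * t"
  have s: "s > 0" using False assms unfolding s_def by (smt (verit) mult_nonneg_nonneg)
  have "(1 - c) * (psi s + ln s * (1 - s)) + c * (psi s + ln s * (t - s))
          \<le> (1 - c) * psi 1 + c * psi t"
    using assms s by (intro add_mono mult_left_mono psi_tangent) auto
  moreover have "(1 - c) * (psi s + ln s * (1 - s)) + c * (psi s + ln s * (t - s))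
      = psi s + ln s * (((1 - c) + c * t) - s)" by (simp add: algebra_simps)
  ultimately show ?thesis by (simp add: s_def)
qed

lemma psi_le_square:
  assumes "t \<ge> 0"
  shows "psi t \<le> (t - 1)\<^sup>2"
proof (cases "t = 0")
  case False
  then have "t > 0" using assms by simp
  then have "t * ln t \<le> t * (t - 1)" by (intro mult_left_mono ln_le_minus_one) auto
  then show ?thesis by (simp add: psi_def power2_eq_square algebra_simps)
qed (simp add: psi_def)

text \<open>The difference of the two sides vanishes at 1 and has derivative
  \<open>ln u - (u - 1) / B\<close>. To the right of 1 this is nonnegative because ln u \<ge> (u -
  1) / u and u \<le> B; to the left it is nonpositive because ln u \<le> u - 1.\<close>

lemma square_le_psi:
  assumes "0 \<le> t" "t \<le> B" "1 \<le> B"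
  shows "(t - 1)\<^sup>2 / (2 * B) \<le> psi t"
proof -
  define f where "f = (\<lambda>t. psi t - (t - 1)\<^sup>2 / (2 * B))"
  have der: "(f has_real_derivative (ln u - (u - 1) / B)) (at u)" if "u > 0" for u
    unfolding f_def psi_def using that assms
    by (auto intro!: derivative_eq_intros simp: field_simps)
  have "f t \<ge> 0"
  proof (cases "t \<ge> 1")
    case True
    have "f 1 \<le> f t"
    proof (rule DERIV_nonneg_imp_nondecreasing[OF True])
      fix u assume u: "1 \<le> u" "u \<le> t"
      have "1 - 1 / u \<le> ln u" using u ln_le_minus_one[of "1 / u"] by (simp add: ln_div)
      moreover have "(u - 1) / B \<le> (u - 1) / u" using u assms by (intro divide_left_mono) auto
      ultimately have "ln u - (u - 1) / B \<ge> 0" using u by (simp add: diff_divide_distrib)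
      then show "\<exists>y. (f has_real_derivative y) (at u) \<and> 0 \<le> y" using der[of u] u by force
    qed
    then show ?thesis by (simp add: f_def)
  next
    case False
    show ?thesis
    proof (cases "t = 0")
      case True
      then show ?thesis using assms by (simp add: f_def psi_def field_simps)
    next
      case t: False
      have "f 1 \<le> f t"
      proof (rule DERIV_nonpos_imp_nonincreasing[of t 1 f])
        show "t \<le> 1" using False by simp
        fix u assume u: "t \<le> u" "u \<le> 1"
        have u0: "u > 0" using u t assms by linarith
        have "ln u \<le> u - 1" using u0 by (rule ln_le_minus_one)
        also have "u - 1 \<le> (u - 1) / B" 
          using mult_nonneg_nonneg[of "B - 1" "1 - u"] u assms by (simp add: field_simps)
        finally show "\<exists>y. (f has_real_derivative y) (at u) \<and> y \<le> 0" using der[OF u0] by force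
      qed
      then show ?thesis by (simp add: f_def)
    qed
  qed
  then show ?thesis by (simp add: f_def)
qed

lemma continuous_on_psi: "continuous_on {0..} psi"
proof -
  have "continuous (at x within {0..}) (\<lambda>t. t * ln t)" if "x \<ge> 0" for x :: real
  proof (cases "x = 0")
    case True
    have "((\<lambda>t::real. t * ln t) \<longlongrightarrow> 0) (at_right 0)" by real_asymp
    then show ?thesis by (simp add: True continuous_within at_within_Ici_at_right)
  next
    case False
    then show ?thesis by (intro continuous_intros) auto
  qed
  then have "continuous_on {0..} (\<lambda>t::real. t * ln t)"
    by (auto simp: continuous_on_eq_continuous_within)
  then have "continuous_on {0..} (\<lambda>t::real. t * ln t - t + 1)"
    by (rule continuous_on_add[OF continuous_on_diff]) (auto intro!: continuous_intros)
  then show ?thesis by (simp add: psi_def[abs_def])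
qed

section \<open>A quadratic modulus of continuity\<close>

text \<open>Uniform continuity settles points closer than \<open>d\<close>; for the others the
  oscillation \<open>2 * B\<close> is at most \<open>2 * B / d\<^sup>2\<close> times the squared
  distance. The summand \<open>B\<close> in the constant lets it bound \<open>g\<close> as
  well.\<close>

lemma continuous_modulus_quadratic:
  fixes g :: "real \<Rightarrow> real"
  assumes "continuous_on {0..1} g" "\<eta> > 0"
  obtains C where "C \<ge> 0"
    "\<And>p q. p \<in> {0..1} \<Longrightarrow> q \<in> {0..1} \<Longrightarrow> g p \<le> g q + \<eta> + C * (p - q)\<^sup>2"
    "\<And>p. p \<in> {0..1} \<Longrightarrow> g p \<le> C"
proof -
  have "uniformly_continuous_on {0..1} g" using assms(1) compact_uniformly_continuous by auto
  then obtain d where d: "d > 0"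
    "\<And>p q. p \<in> {0..1} \<Longrightarrow> q \<in> {0..1} \<Longrightarrow> dist p q < d \<Longrightarrow> dist (g p) (g q) < \<eta>"
    unfolding uniformly_continuous_on_def using \<open>\<eta> > 0\<close> by metis
  have "compact (g ` {0..1})" using assms(1) by (intro compact_continuous_image) auto
  then obtain B where B: "B > 0" "\<And>p. p \<in> {0..1} \<Longrightarrow> \<bar>g p\<bar> \<le> B"
    using compact_imp_bounded bounded_pos by (metis image_eqI real_norm_def)
  define C where "C = B + 2 * B / d\<^sup>2"
  have C: "C \<ge> 0" "C \<ge> B" using B d by (auto simp: C_def)
  show ?thesis
  proof (rule that[OF C(1)])
    fix p q :: real assume pq: "p \<in> {0..1}" "q \<in> {0..1}"
    show "g p \<le> g q + \<eta> + C * (p - q)\<^sup>2"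
    proof (cases "dist p q < d")
      case True
      from d(2)[OF pq True] have "g p \<le> g q + \<eta>" by (simp add: dist_real_def abs_less_iff)
      moreover have "C * (p - q)\<^sup>2 \<ge> 0" using C by simp
      ultimately show ?thesis by linarith
    next
      case False
      have "d\<^sup>2 \<le> \<bar>p - q\<bar>\<^sup>2" using False d by (intro power_mono) (auto simp: dist_real_def)
      then have "2 * B / d\<^sup>2 * d\<^sup>2 \<le> C * (p - q)\<^sup>2"
        using B d C by (intro mult_mono) (auto simp: C_def)
      then have "2 * B \<le> C * (p - q)\<^sup>2" using d by simp
      then show ?thesis using B(2)[OF pq(1)] B(2)[OF pq(2)] \<open>\<eta> > 0\<close> by linarith
    qed
  next
    fix p :: real assume "p \<in> {0..1}"
    then show "g p \<le> C" using B(2)[of p] C by auto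
  qed
qed

text \<open>The function \<open>kap\<close> is odd about \<open>1/2\<close>, concave on \<open>[0, 1/2]\<close> and convex on \<open>[1/2, 1]\<close>.\<close>

definition kap :: "real \<Rightarrow> real" where
  "kap p = (1 - p) * ln (1 - p) - p * ln p"

text \<open>The slope is the derivative of \<open>kap\<close> at \<open>c\<close>, so this is
  concavity on the left half in tangent form. The difference has derivative
  \<open>ln (c * (1 - c)) - ln (u * (1 - u))\<close>, which changes sign only at \<open>c\<close>
  because u (1 - u) increases up to 1/2.\<close>

lemma kap_tangent:
  assumes "0 \<le> p" "p \<le> 1/2" "0 < c" "c \<le> 1/2"
  shows "kap p \<le> kap c + (- ln c - ln (1 - c) - 2) * (p - c)"
proof -
  define f where "f = (\<lambda>p. kap p - (- ln c - ln (1 - c) - 2) * (p - c))"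
  have der: "(f has_real_derivative (ln (c * (1 - c)) - ln (u * (1 - u)))) (at u)"
    if "u > 0" "u \<le> 1/2" for u
  proof -
    have "((\<lambda>p. (1 - p) * ln (1 - p)) has_real_derivative (- ln (1 - u) - 1)) (at u)"
      "((\<lambda>p. p * ln p) has_real_derivative (ln u + 1)) (at u)"
      using that by (auto intro!: derivative_eq_intros)
    moreover have "((\<lambda>p. (- ln c - ln (1 - c) - 2) * (p - c))
        has_real_derivative (- ln c - ln (1 - c) - 2)) (at u)"
      by (auto intro!: derivative_eq_intros)
    ultimately have "(f has_real_derivative ((- ln (1 - u) - 1) - (ln u + 1) - (- ln c - ln (1 - c) - 2))) (at u)"
      unfolding f_def kap_def by (intro DERIV_diff)
    moreover have "(- ln (1 - u) - 1) - (ln u + 1) - (- ln c - ln (1 - c) - 2)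
        = ln (c * (1 - c)) - ln (u * (1 - u))" using that assms by (simp add: ln_mult)
    ultimately show ?thesis by simp
  qed
  have mono: "x * (1 - x) \<le> y * (1 - y)" if "x \<le> y" "y \<le> 1/2" for x y :: real
  proof -
    have "0 \<le> (y - x) * (1 - x - y)" using that by simp
    then show ?thesis by (simp add: algebra_simps)
  qed
  have "f p \<le> f c"
  proof (cases "p \<ge> c")
    case True
    show ?thesis
    proof (rule DERIV_nonpos_imp_nonincreasing[OF True])
      fix u assume u: "c \<le> u" "u \<le> p"
      have "c * (1 - c) \<le> u * (1 - u)" using mono[of c u] u assms by simp
      then have "ln (c * (1 - c)) \<le> ln (u * (1 - u))"
        using u assms by (intro ln_mono) auto
      then show "\<exists>y. (f has_real_derivative y) (at u) \<and> y \<le> 0"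
        using der[of u] u assms by force
    qed
  next
    case False
    show ?thesis
    \<comment> \<open>No derivative is available at 0. There the claim reduces to - ln (1 - c) \<le>
      2 c, which is where c \<le> 1/2 enters.\<close>
    proof (cases "p = 0")
      case True
      have "ln (1 / (1 - c)) \<le> 1 / (1 - c) - 1" using assms by (intro ln_le_minus_one) simp
      also have "\<dots> \<le> 2 * c" using assms by (simp add: field_simps)
      finally have "- ln (1 - c) \<le> 2 * c" using assms by (simp add: ln_div)
      then show ?thesis using True by (simp add: f_def kap_def algebra_simps)
    next
      case p: False
      show ?thesis
      proof (rule DERIV_nonneg_imp_nondecreasing[of p c f])
        show "p \<le> c" using False by simp
        fix u assume u: "p \<le> u" "u \<le> c"
        have u0: "u > 0" using u p assms by linarith
        have "u * (1 - u) \<le> c * (1 - c)" using mono[of u c] u assms by simp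
        then have "ln (u * (1 - u)) \<le> ln (c * (1 - c))"
          using u0 u assms by (intro ln_mono) auto
        then show "\<exists>y. (f has_real_derivative y) (at u) \<and> 0 \<le> y"
          using der[of u] u0 u assms by force
      qed
    qed
  qed
  then show ?thesis by (simp add: f_def)
qed

text \<open>
  At most one mass exceeds \<open>1/2\<close>, so Jensen's inequality on the concave branch of \<open>kap\<close> levels all masses
  except the largest one. The left-hand side below is the resulting value when the largest
  mass is \<open>1 - s\<close>; it increases up to the uniform distribution.
\<close>

lemma kap_split_mono:
  fixes r :: nat
  assumes "r \<ge> 2" "0 \<le> s" "s \<le> 1 - 1 / r"
  shows "(real r - 1) * kap (s / (real r - 1)) + kap (1 - s) \<le> r * kap (1 / r)"
proof -
  define m where "m = real r - 1"
  have m: "m \<ge> 1" using assms by (simp add: m_def)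
  have rm: "real r = m + 1" by (simp add: m_def)
  \<comment> \<open>The terms s ln s of the two summands cancel, which makes this form
    differentiable at \<open>s = 0\<close> too.\<close>
  define g where "g = (\<lambda>s. s * ln m + (m - s) * ln ((m - s) / m) - (1 - s) * ln (1 - s))"
  have eq: "m * kap (s / m) + kap (1 - s) = g s" if "0 \<le> s" "s < 1" for s
  proof (cases "s = 0")
    case True
    then show ?thesis using m by (simp add: g_def kap_def)
  next
    case False
    then have "s > 0" using that by simp
    have "m * kap (s / m) = (m - s) * ln ((m - s) / m) - s * ln (s / m)"
      using m by (simp add: kap_def field_simps)
    then show ?thesis using m \<open>s > 0\<close> by (simp add: g_def kap_def ln_div algebra_simps)
  qed
  define e where "e = 1 - 1 / real r"
  have e: "e = m / (m + 1)" using m rm by (simp add: e_def field_simps)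
  have e1: "e < 1" "e \<ge> 0" using m by (auto simp: e)
  have "g s \<le> g e"
  proof (rule DERIV_nonneg_imp_nondecreasing[of s e g])
    show "s \<le> e" using assms by (simp add: e_def)
    fix u assume u: "s \<le> u" "u \<le> e"
    have u1: "u < 1" "u \<ge> 0" using u e1 assms by linarith+
    have um: "u < m" using u1 m by linarith
    have "((\<lambda>s. (1 - s) * ln (1 - s)) has_real_derivative (- ln (1 - u) - 1)) (at u)"
      "((\<lambda>s. (m - s) * ln ((m - s) / m)) has_real_derivative (- ln ((m - u) / m) - 1)) (at u)"
      "((\<lambda>s. s * ln m) has_real_derivative ln m) (at u)"
      using u1 m um by (auto intro!: derivative_eq_intros)
    then have "(g has_real_derivative (ln m + (- ln ((m - u) / m) - 1) - (- ln (1 - u) - 1))) (at u)"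
      unfolding g_def by (intro DERIV_diff DERIV_add)
    then have d: "(g has_real_derivative (ln m - ln ((m - u) / m) + ln (1 - u))) (at u)"
      by (simp add: algebra_simps)
    \<comment> \<open>The derivative is nonnegative iff m - u \<le> m^2 (1 - u), that is, (m - 1) (m
      - u (m + 1)) \<ge> 0. The second factor vanishes exactly at the uniform endpoint
      \<open>e\<close>.\<close>
    have "u * (m + 1) \<le> m" using u m by (simp add: e field_simps)
    then have "u * (m + 1) * (m - 1) \<le> m * (m - 1)" using m by (intro mult_right_mono) auto
    then have "m - u \<le> m * m * (1 - u)" by (simp add: algebra_simps)
    then have "(m - u) / m \<le> m * (1 - u)" using m by (simp add: field_simps)
    then have "ln ((m - u) / m) \<le> ln (m * (1 - u))" using um m u1 by (intro ln_mono) auto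
    then have "ln m - ln ((m - u) / m) + ln (1 - u) \<ge> 0" using m u1 by (simp add: ln_mult)
    then show "\<exists>y. (g has_real_derivative y) (at u) \<and> 0 \<le> y" using d by blast
  qed
  also have "g e = m * kap (e / m) + kap (1 - e)" using eq[of e] e1 by simp
  also have "\<dots> = r * kap (1 / r)"
  proof -
    have "e / m = 1 / r" using m rm by (simp add: e)
    moreover have "1 - e = 1 / r" by (simp add: e_def)
    ultimately have "m * kap (e / m) + kap (1 - e) = (m + 1) * kap (1 / r)"
      by (simp only: distrib_right mult_1)
    then show ?thesis by (simp only: rm)
  qed
  finally have "g s \<le> r * kap (1 / r)" .
  moreover have "s < 1" using assms(3) e1(1) unfolding e_def by linarith
  ultimately show ?thesis using eq[of s] assms by (simp add: m_def)
qed

text \<open>After cancelling linear terms, the contraction bound for unequal colours says precisely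
  that the uniform law maximises this sum. Since \<open>kap\<close> is not concave on the whole
  interval, Jensen alone does not give it.\<close>

lemma sum_kap_le:
  fixes q :: "'a \<Rightarrow> real"
  assumes fin: "finite X" and r: "card X \<ge> 2"
    and q: "\<And>x. x \<in> X \<Longrightarrow> q x \<ge> 0" "sum q X = 1"
  shows "(\<Sum>x\<in>X. kap (q x)) \<le> card X * kap (1 / card X)"
proof -
  define r where "r = card X"
  have X0: "X \<noteq> {}" using r by auto
  obtain z where z: "z \<in> X" "\<And>x. x \<in> X \<Longrightarrow> q x \<le> q z"
    using Max_in[of "q ` X"] Max_ge[of "q ` X"] fin X0 by (metis (no_types, lifting) empty_is_image finite_imageI imageE imageI)
  define s where "s = 1 - q z"
  have sumr: "(\<Sum>x\<in>X - {z}. q x) = s"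
    using q(2) sum.remove[OF fin z(1), of q] by (simp add: s_def)
  \<comment> \<open>Such a mass is at most \<open>q z\<close> and also at most
    \<open>1 - q z\<close>.\<close>
  have half: "q x \<le> 1/2" if "x \<in> X - {z}" for x
  proof -
    have "q x \<le> s" unfolding sumr[symmetric] using that fin q by (intro member_le_sum) auto
    then show ?thesis using z(2)[of x] that by (simp add: s_def)
  qed
  have s0: "s \<ge> 0" unfolding sumr[symmetric] using q by (intro sum_nonneg) auto
  have "sum q X \<le> (\<Sum>x\<in>X. q z)" using z by (intro sum_mono) auto
  then have "1 / r \<le> q z" using q X0 fin by (simp add: r_def field_simps card_gt_0_iff)
  then have s1: "s \<le> 1 - 1 / r" by (simp add: s_def)
  define c where "c = s / (real r - 1)"
  have card: "real (card (X - {z})) = real r - 1" using fin z r by (simp add: r_def)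
  have rest: "(\<Sum>x\<in>X - {z}. kap (q x)) \<le> (real r - 1) * kap c"
  \<comment> \<open>A point mass is treated apart because the tangent inequality needs a positive
    base point.\<close>
  proof (cases "s = 0")
    case True
    have "q x = 0" if "x \<in> X - {z}" for x
      using sumr True that fin q sum_nonneg_eq_0_iff[of "X - {z}" q] by auto
    then show ?thesis by (simp add: c_def True kap_def)
  next
    case False
    then have c0: "c > 0" using s0 r by (simp add: c_def r_def)
    have "s \<le> (real r - 1) / 2"
    proof -
      have "s \<le> (\<Sum>x\<in>X - {z}. 1/2)" unfolding sumr[symmetric] by (intro sum_mono half) auto
      then show ?thesis using card by simp
    qed
    then have c1: "c \<le> 1/2" using r by (simp add: c_def r_def field_simps)
    have "(\<Sum>x\<in>X - {z}. kap (q x))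
        \<le> (\<Sum>x\<in>X - {z}. kap c + (- ln c - ln (1 - c) - 2) * (q x - c))"
      using half q c0 c1 by (intro sum_mono kap_tangent) auto
    also have "\<dots> = (real r - 1) * kap c + (- ln c - ln (1 - c) - 2) * (s - (real r - 1) * c)"
      using card by (simp add: sum.distrib sum_distrib_left[symmetric] sum_subtractf sumr)
    also have "(real r - 1) * c = s" using r by (simp add: c_def r_def)
    finally show ?thesis by simp
  qed
  have "(\<Sum>x\<in>X. kap (q x)) = kap (q z) + (\<Sum>x\<in>X - {z}. kap (q x))"
    using sum.remove[OF fin z(1)] by simp
  also have "\<dots> \<le> (real r - 1) * kap (s / (real r - 1)) + kap (1 - s)"
    using rest by (simp add: c_def s_def)
  also have "\<dots> \<le> r * kap (1 / r)" using kap_split_mono[OF _ s0 s1] r by (simp add: r_def)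
  finally show ?thesis by (simp add: r_def)
qed


section \<open>Relative entropy to the uniform law\<close>

definition kl_unif :: "'a set \<Rightarrow> ('a \<Rightarrow> real) \<Rightarrow> real" where
  "kl_unif X q = (\<Sum>x\<in>X. q x * ln (real (card X) * q x))"

definition psi_eq :: "nat \<Rightarrow> real \<Rightarrow> real" where
  "psi_eq r p = psi (r * p)"

text \<open>The argument of \<open>psi\<close> is the density, relative to the uniform law, of a
  uniformly chosen different colour. The prefactor \<open>r - 1\<close> offsets the contraction of
  that channel, so that \<open>psi_eq\<close> and \<open>psi_neq\<close> get the same bound.\<close>

definition psi_neq :: "nat \<Rightarrow> real \<Rightarrow> real" where
  "psi_neq r p = (real r - 1) * psi (r * (1 - p) / (real r - 1))"

lemma sum_psi_eq:
  assumes "finite X" "X \<noteq> {}" "sum q X = 1"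
  shows "(\<Sum>x\<in>X. psi_eq (card X) (q x)) = card X * kl_unif X q"
proof -
  have "(\<Sum>x\<in>X. psi_eq (card X) (q x))
      = (\<Sum>x\<in>X. card X * (q x * ln (card X * q x))) - card X * sum q X + card X"
    by (simp add: psi_eq_def psi_def sum.distrib sum_subtractf sum_distrib_left mult.assoc)
  then show ?thesis using assms by (simp add: kl_unif_def sum_distrib_left)
qed

text \<open>
  This is the contraction factor \<open>1/(r - 1)\<close> of relative entropy under the channel that replaces a
  colour by a uniformly chosen different one.
\<close>

lemma sum_psi_neq_le:
  assumes fin: "finite X" and r: "card X \<ge> 2"
    and q: "\<And>x. x \<in> X \<Longrightarrow> q x \<ge> 0" "sum q X = 1"
  shows "(\<Sum>x\<in>X. psi_neq (card X) (q x)) \<le> card X * kl_unif X q"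
proof -
  define r where "r = card X"
  define m where "m = real r - 1"
  have m: "m > 0" "real r = m + 1" using r by (auto simp: m_def r_def)
  have le1: "q x \<le> 1" if "x \<in> X" for x
    using member_le_sum[of x X q] that q fin by auto
  define L where "L = ln (real r / m)"
  have neq: "psi_neq r (q x) = r * ((1 - q x) * ln (1 - q x) + (1 - q x) * L) - r * (1 - q x) + m"
    if "x \<in> X" for x
  proof (cases "q x = 1")
    case True
    then show ?thesis by (simp add: psi_neq_def psi_def m_def)
  next
    case False
    then have "1 - q x > 0" using le1[OF that] by simp
    then have "ln (r * (1 - q x) / m) = ln (1 - q x) + L"
      using m by (simp add: L_def ln_mult ln_div)
    then have "psi_neq r (q x) = m * (r * (1 - q x) / m * (ln (1 - q x) + L) - r * (1 - q x) / m + 1)"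
      by (simp add: psi_neq_def psi_def m_def[symmetric])
    also have "\<dots> = r * ((1 - q x) * ln (1 - q x) + (1 - q x) * L) - r * (1 - q x) + m"
      using m by (simp add: field_simps)
    finally show ?thesis .
  qed
  have s1: "(\<Sum>x\<in>X. 1 - q x) = m" using q by (simp add: sum_subtractf m_def r_def)
  have "(\<Sum>x\<in>X. psi_neq r (q x))
      = (\<Sum>x\<in>X. r * ((1 - q x) * ln (1 - q x) + (1 - q x) * L) - r * (1 - q x) + m)"
    by (intro sum.cong refl neq)
  also have "\<dots> = r * ((\<Sum>x\<in>X. (1 - q x) * ln (1 - q x)) + (\<Sum>x\<in>X. 1 - q x) * L)
      - r * (\<Sum>x\<in>X. 1 - q x) + r * m"
    by (simp only: sum.distrib sum_subtractf sum_distrib_left[symmetric] sum_distrib_right[symmetric]) (simp add: r_def)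
  finally have "(\<Sum>x\<in>X. psi_neq r (q x))
      = r * ((\<Sum>x\<in>X. (1 - q x) * ln (1 - q x)) + m * L) - r * m + r * m" by (simp only: s1)
  then have A: "(\<Sum>x\<in>X. psi_neq r (q x)) = r * ((\<Sum>x\<in>X. (1 - q x) * ln (1 - q x)) + m * L)"
    by simp
  have eq: "q x * ln (r * q x) = q x * ln (q x) + q x * ln r" if "x \<in> X" for x
    
  proof (cases "q x = 0")
    case False
    then have "ln (r * q x) = ln r + ln (q x)" using q(1)[OF that] r by (simp add: ln_mult r_def)
    then show ?thesis by (simp only: distrib_left)
  qed simp
  have B: "kl_unif X q = (\<Sum>x\<in>X. q x * ln (q x)) + ln r"
    by (simp add: kl_unif_def eq sum.distrib sum_distrib_right[symmetric] q r_def[symmetric])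
  have "(\<Sum>x\<in>X. kap (q x)) \<le> r * kap (1 / r)" using sum_kap_le[OF fin r q] by (simp add: r_def)
  \<comment> \<open>These are exactly the constants left over in \<open>A\<close> and
    \<open>B\<close>, so the contraction bound is tight at the uniform law.\<close>
  moreover have "r * kap (1 / r) = ln r - m * L"
  proof -
    have "1 - 1 / real r = m / r" using m by (simp add: field_simps)
    moreover have "ln (m / r) = - L" "ln (1 / real r) = - ln r" using m by (auto simp: L_def ln_div)
    ultimately have "kap (1 / r) = (m / r) * (- L) - (1 / r) * (- ln r)"
      unfolding kap_def by simp
    then show ?thesis using r by (simp add: right_diff_distrib r_def)
  qed
  moreover have "(\<Sum>x\<in>X. kap (q x)) = (\<Sum>x\<in>X. (1 - q x) * ln (1 - q x)) - (\<Sum>x\<in>X. q x * ln (q x))"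
    by (simp add: kap_def sum_subtractf)
  ultimately have "(\<Sum>x\<in>X. (1 - q x) * ln (1 - q x)) + m * L \<le> kl_unif X q" using B by simp
  then show ?thesis using A by (simp add: r_def[symmetric] mult_left_mono)
qed

text \<open>All densities \<open>r * q x\<close> lie between 0 and \<open>r\<close>, so
  \<open>square_le_psi\<close> applies with \<open>B = r\<close>. The powers of \<open>r\<close>
  then cancel, and a constant free of \<open>r\<close> remains.\<close>

lemma sum_square_le_kl_unif:
  assumes fin: "finite X" and X: "X \<noteq> {}"
    and q: "\<And>x. x \<in> X \<Longrightarrow> q x \<ge> 0" "sum q X = 1"
  shows "(\<Sum>x\<in>X. (q x)\<^sup>2) - 1 / card X \<le> 2 * kl_unif X q"
proof -
  define r where "r = real (card X)"
  have r: "r \<ge> 1" using fin X by (simp add: r_def Suc_le_eq card_gt_0_iff)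
  have le1: "q x \<le> 1" if "x \<in> X" for x
    using member_le_sum[of x X q] that q fin by auto
  have "(\<Sum>x\<in>X. (r * q x - 1)\<^sup>2 / (2 * r)) \<le> (\<Sum>x\<in>X. psi (r * q x))"
    using q le1 r by (intro sum_mono square_le_psi) auto
  also have "\<dots> = r * kl_unif X q"
    using sum_psi_eq[OF fin X q(2)] by (simp add: psi_eq_def r_def)
  finally have "(\<Sum>x\<in>X. (r * q x - 1)\<^sup>2) \<le> 2 * r * (r * kl_unif X q)"
    using r by (simp add: sum_divide_distrib[symmetric] field_simps)
  moreover have "(\<Sum>x\<in>X. (r * q x - 1)\<^sup>2) = r * r * (\<Sum>x\<in>X. (q x)\<^sup>2) - 2 * r * sum q X + r"
  proof -
    have "(\<Sum>x\<in>X. (r * q x - 1)\<^sup>2) = (\<Sum>x\<in>X. r * r * (q x)\<^sup>2 - 2 * r * q x + 1)"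
      by (intro sum.cong refl) (simp add: power2_eq_square algebra_simps)
    then show ?thesis by (simp only: sum.distrib sum_subtractf sum_distrib_left[symmetric]) (simp add: r_def)
  qed
  ultimately have "r * r * (\<Sum>x\<in>X. (q x)\<^sup>2) - r \<le> r * r * (2 * kl_unif X q)" using q by simp
  moreover have "r * r * ((\<Sum>x\<in>X. (q x)\<^sup>2) - 1 / r) = r * r * (\<Sum>x\<in>X. (q x)\<^sup>2) - r"
    using r by (simp add: algebra_simps)
  ultimately have "r * r * ((\<Sum>x\<in>X. (q x)\<^sup>2) - 1 / r) \<le> r * r * (2 * kl_unif X q)" by simp
  then show ?thesis using r by (simp add: r_def[symmetric])
qed

lemma continuous_on_psi_eq: "continuous_on {0..1} (psi_eq r)"
proof -
  have "continuous_on {0..1} (\<lambda>p. psi (real r * p))"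
    by (rule continuous_on_compose2[OF continuous_on_psi]) (auto intro!: continuous_intros)
  then show ?thesis by (simp add: psi_eq_def[abs_def])
qed

lemma continuous_on_psi_neq:
  assumes "r \<ge> 2"
  shows "continuous_on {0..1} (psi_neq r)"
proof -
  have "continuous_on {0..1} (\<lambda>p. psi (real r * (1 - p) / (real r - 1)))"
    using assms by (intro continuous_on_compose2[OF continuous_on_psi]) (auto intro!: continuous_intros)
  then show ?thesis unfolding psi_neq_def[abs_def] by (intro continuous_intros)
qed

section \<open>Information carried by one edge label\<close>

definition edge_law :: "'c pmf \<Rightarrow> 'c pmf \<Rightarrow> real \<Rightarrow> 'c \<Rightarrow> real" where
  "edge_law P Q p y = pmf Q y + p * (pmf P y - pmf Q y)"

text \<open>\<open>1 / r\<close> is the prior probability that two vertices share a colour. This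
  fixed law serves as reference in place of the true predictive law of the label, which would depend
  on everything observed before.\<close>

definition edge_avg :: "nat \<Rightarrow> 'c pmf \<Rightarrow> 'c pmf \<Rightarrow> 'c \<Rightarrow> real" where
  "edge_avg r P Q y = edge_law P Q (1 / r) y"

definition edge_kl :: "nat \<Rightarrow> 'c::finite pmf \<Rightarrow> 'c pmf \<Rightarrow> real \<Rightarrow> real" where
  "edge_kl r P Q p = (\<Sum>y\<in>UNIV. edge_law P Q p y * ln (edge_law P Q p y / edge_avg r P Q y))"

lemma edge_law_nonneg: "0 \<le> p \<Longrightarrow> p \<le> 1 \<Longrightarrow> edge_law P Q p y \<ge> 0"
proof -
  assume p: "0 \<le> p" "p \<le> 1"
  have "edge_law P Q p y = (1 - p) * pmf Q y + p * pmf P y" by (simp add: edge_law_def algebra_simps)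
  then show ?thesis using p by simp
qed

lemma sum_edge_law: "(\<Sum>y\<in>UNIV. edge_law P Q p (y::'c::finite)) = 1"
proof -
  have "(\<Sum>y\<in>UNIV. pmf P y) = 1" "(\<Sum>y\<in>UNIV. pmf Q y) = 1" by (simp_all add: sum_pmf_eq_1)
  then show ?thesis by (simp add: edge_law_def sum.distrib sum_subtractf sum_distrib_left[symmetric])
qed

lemma edge_avg_eq_0D:
  assumes "r \<ge> 2" "edge_avg r P Q y = 0"
  shows "pmf P y = 0" "pmf Q y = 0"
proof -
  have "edge_avg r P Q y = (1 - 1 / r) * pmf Q y + (1 / r) * pmf P y"
    by (simp add: edge_avg_def edge_law_def algebra_simps)
  moreover have "1 - 1 / real r > 0" "1 / real r > 0" using assms by auto
  ultimately show "pmf P y = 0" "pmf Q y = 0" using assms(2)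
    by (simp_all add: add_nonneg_eq_0_iff)
qed

lemma edge_avg_pos:
  assumes "r \<ge> 2" "edge_law P Q p y \<noteq> 0"
  shows "edge_avg r P Q y > 0"
proof -
  have "edge_avg r P Q y \<noteq> 0" using edge_avg_eq_0D[OF assms(1), of P Q y] assms(2) by (auto simp: edge_law_def)
  moreover have "edge_avg r P Q y \<ge> 0" using assms by (auto simp: edge_avg_def intro!: edge_law_nonneg)
  ultimately show ?thesis by simp
qed

text \<open>
  The label \<open>z\<close> will be the absence of an edge: its likely outcome carries an information quadratic in
  \<open>pmf P z - pmf Q z\<close>, while the rare labels contribute linearly.
\<close>

lemma edge_kl_le:
  fixes P Q :: "'c::finite pmf"
  assumes r: "r \<ge> 2" and p: "0 \<le> p" "p \<le> 1"
  shows "edge_kl r P Q p \<le>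
    ((\<Sum>y\<in>UNIV - {z}. max 0 (pmf P y - pmf Q y)) * psi_eq r p
      + (\<Sum>y\<in>UNIV - {z}. max 0 (pmf Q y - pmf P y)) * psi_neq r p) / r
    + (pmf P z - pmf Q z)\<^sup>2 / edge_avg r P Q z"
proof -
  define R where "R = edge_avg r P Q"
  define K where "K = edge_law P Q p"
  have r0: "real r > 1" using r by simp
  have K0: "K y \<ge> 0" for y using p by (simp add: K_def edge_law_nonneg)
  have R0: "R y \<ge> 0" for y using r by (auto simp: R_def edge_avg_def intro!: edge_law_nonneg)
  have KR: "K y = 0 \<and> pmf P y = 0 \<and> pmf Q y = 0" if "R y = 0" for y
    using edge_avg_eq_0D[OF r, of P Q y] that by (simp add: R_def K_def edge_law_def)
  have diff: "K y - R y = (p - 1 / r) * (pmf P y - pmf Q y)" for y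
    by (simp add: K_def R_def edge_law_def edge_avg_def algebra_simps)
  \<comment> \<open>Both laws have total mass one, so the added terms cancel. They make every
    summand nonnegative, and the labels can be estimated one by one.\<close>
  have "edge_kl r P Q p = (\<Sum>y\<in>UNIV. K y * ln (K y / R y) - K y + R y)"
    by (simp add: edge_kl_def K_def R_def sum.distrib sum_subtractf edge_avg_def sum_edge_law)
  also have "\<dots> = (\<Sum>y\<in>UNIV. R y * psi (K y / R y))"
  proof (rule sum.cong[OF refl])
    fix y show "K y * ln (K y / R y) - K y + R y = R y * psi (K y / R y)"
      using KR[of y] by (cases "R y = 0") (auto simp: psi_def field_simps)
  qed
  also have "\<dots> = R z * psi (K z / R z) + (\<Sum>y\<in>UNIV - {z}. R y * psi (K y / R y))"
    by (rule sum.remove) auto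
  also have "\<dots> \<le> (pmf P z - pmf Q z)\<^sup>2 / R z
      + (\<Sum>y\<in>UNIV - {z}. max 0 (pmf P y - pmf Q y) / r * psi_eq r p
          + max 0 (pmf Q y - pmf P y) / r * psi_neq r p)"
  proof (intro add_mono sum_mono)
    show "R z * psi (K z / R z) \<le> (pmf P z - pmf Q z)\<^sup>2 / R z"
    proof (cases "R z = 0")
      case False
      then have Rz: "R z > 0" using R0[of z] by simp
      have "R z * psi (K z / R z) \<le> R z * (K z / R z - 1)\<^sup>2"
        using K0[of z] Rz by (intro mult_left_mono psi_le_square) auto
      also have "\<dots> = (K z - R z)\<^sup>2 / R z" using Rz by (simp add: field_simps power2_eq_square)
      also have "(K z - R z)\<^sup>2 \<le> (pmf P z - pmf Q z)\<^sup>2"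
      proof -
        have "0 \<le> 1 / real r" "1 / real r \<le> 1" using r0 by auto
        then have "\<bar>p - 1 / r\<bar> \<le> 1" using p unfolding abs_le_iff by linarith
        then have "(p - 1 / r)\<^sup>2 \<le> 1" by (simp add: abs_square_le_1)
        then show ?thesis by (simp add: diff power_mult_distrib mult_left_le_one_le)
      qed
      finally show ?thesis using Rz by (simp add: divide_right_mono)
    qed simp
    fix y assume "y \<in> UNIV - {z}"
    show "R y * psi (K y / R y) \<le> max 0 (pmf P y - pmf Q y) / r * psi_eq r p
          + max 0 (pmf Q y - pmf P y) / r * psi_neq r p"
    proof (cases "R y = 0")
      case True
      then show ?thesis using KR[of y] by simp
    next
      case False
      then have Ry: "R y > 0" using R0[of y] by simp
      show ?thesis
      proof (cases "pmf P y \<ge> pmf Q y")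
        case True
        \<comment> \<open>The share of \<open>R y\<close> due to the excess of \<open>P\<close> over
          \<open>Q\<close>. With it the ratio \<open>K y / R y\<close> is a mixture of 1 and the
          density \<open>r * p\<close>.\<close>
        define c where "c = (pmf P y - pmf Q y) / r / R y"
        have Req: "R y = pmf Q y + (pmf P y - pmf Q y) / r"
          by (simp add: R_def edge_avg_def edge_law_def)
        have c: "0 \<le> c" "c \<le> 1" using True Ry r0 Req by (auto simp: c_def field_simps)
        have "K y / R y = 1 + (p - 1 / r) * (pmf P y - pmf Q y) / R y"
          using Ry by (simp add: diff[symmetric] diff_divide_distrib)
        also have "\<dots> = (1 - c) + c * (r * p)"
          using Ry r0 by (simp add: c_def field_simps)
        finally have "K y / R y = (1 - c) + c * (r * p)" .
        then have "psi (K y / R y) \<le> c * psi (r * p)"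
          using psi_mix_one_le[OF c, of "r * p"] p by simp
        then have "R y * psi (K y / R y) \<le> R y * (c * psi (r * p))" using Ry by (intro mult_left_mono) auto
        also have "\<dots> = (pmf P y - pmf Q y) / r * psi_eq r p" using Ry by (simp add: c_def psi_eq_def)
        finally show ?thesis using True by (simp add: max_absorb1 max_absorb2)
      next
        case False
        \<comment> \<open>Now the excess belongs to unequal colours, whose prior probability is (r -
          1) / r; the ratio becomes a mixture of 1 and the density in
          \<open>psi_neq\<close>.\<close>
        define c where "c = (pmf Q y - pmf P y) * (real r - 1) / r / R y"
        have Req: "R y = pmf P y + (pmf Q y - pmf P y) * (real r - 1) / r"
          using r0 by (simp add: R_def edge_avg_def edge_law_def field_simps)
        have t: "(pmf Q y - pmf P y) * (real r - 1) / r \<ge> 0" using False r0 by simp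
        moreover have "(pmf Q y - pmf P y) * (real r - 1) / r \<le> R y" unfolding Req by simp
        ultimately have c: "0 \<le> c" "c \<le> 1"
          unfolding c_def using divide_nonneg_pos[OF _ Ry] divide_le_eq_1_pos[OF Ry] by blast+
        have "c * (r * (1 - p) / (real r - 1)) = (pmf Q y - pmf P y) * (1 - p) / R y"
          using Ry r0 by (simp add: c_def field_simps)
        moreover have "1 - c = pmf P y / R y"
        proof -
          have "1 - c = (R y - (pmf Q y - pmf P y) * (real r - 1) / r) / R y"
            unfolding c_def diff_divide_distrib using Ry by simp
          moreover have "R y - (pmf Q y - pmf P y) * (real r - 1) / r = pmf P y" using Req by linarith
          ultimately show ?thesis by simp
        qed
        moreover have "K y = pmf P y + (pmf Q y - pmf P y) * (1 - p)"
          by (simp add: K_def edge_law_def algebra_simps)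
        ultimately have "K y / R y = (1 - c) + c * (r * (1 - p) / (real r - 1))"
          by (simp add: add_divide_distrib)
        then have "psi (K y / R y) \<le> c * psi (r * (1 - p) / (real r - 1))"
          using psi_mix_one_le[OF c, of "r * (1 - p) / (real r - 1)"] p r0 by simp
        then have "R y * psi (K y / R y) \<le> R y * (c * psi (r * (1 - p) / (real r - 1)))"
          using Ry by (intro mult_left_mono) auto
        also have "\<dots> = (pmf Q y - pmf P y) / r * psi_neq r p" using Ry by (simp add: c_def psi_neq_def)
        finally show ?thesis using False by (simp add: max_def)
      qed
    qed
  qed
  also have "(\<Sum>y\<in>UNIV - {z}. max 0 (pmf P y - pmf Q y) / r * psi_eq r p
          + max 0 (pmf Q y - pmf P y) / r * psi_neq r p)
      = ((\<Sum>y\<in>UNIV - {z}. max 0 (pmf P y - pmf Q y)) * psi_eq r p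
      + (\<Sum>y\<in>UNIV - {z}. max 0 (pmf Q y - pmf P y)) * psi_neq r p) / r"
    by (simp add: sum.distrib sum_distrib_right add_divide_distrib sum_divide_distrib)
  finally show ?thesis by (simp add: R_def)
qed

section \<open>Posteriors under finitely supported laws\<close>

abbreviation expect :: "'w pmf \<Rightarrow> ('w \<Rightarrow> real) \<Rightarrow> real" where
  "expect M \<equiv> measure_pmf.expectation M"

text \<open>Conditioning is on the level set of \<open>f\<close> through \<open>w\<close>, so a
  posterior is an ordinary function of the outcome, constant on these sets. Outside the support the
  denominator may vanish, and the value is then 0.\<close>

definition post :: "'w pmf \<Rightarrow> ('w \<Rightarrow> 'o) \<Rightarrow> ('w \<Rightarrow> bool) \<Rightarrow> 'w \<Rightarrow> real" where
  "post M f B w = measure_pmf.prob M {u. B u \<and> f u = f w} / measure_pmf.prob M {u. f u = f w}"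

text \<open>This is the mutual information of \<open>Z\<close> and \<open>f\<close> when \<open>Z\<close> is uniform on \<open>r\<close> values.\<close>

definition info :: "nat \<Rightarrow> 'w pmf \<Rightarrow> ('w \<Rightarrow> 'o) \<Rightarrow> ('w \<Rightarrow> 'z) \<Rightarrow> real" where
  "info r M f Z = expect M (\<lambda>w. ln (r * post M f (\<lambda>u. Z u = Z w) w))"

definition post_energy :: "'z set \<Rightarrow> 'w pmf \<Rightarrow> ('w \<Rightarrow> 'o) \<Rightarrow> ('w \<Rightarrow> 'z) \<Rightarrow> real" where
  "post_energy X M f Z = (\<Sum>x\<in>X. expect M (\<lambda>w. (post M f (\<lambda>u. Z u = x) w)\<^sup>2))"

lemma expect_finite:
  assumes "finite (set_pmf M)"
  shows "expect M g = (\<Sum>w\<in>set_pmf M. g w * pmf M w)"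
  using assms by (intro integral_measure_pmf_real) auto

lemma expect_mono:
  assumes "finite (set_pmf M)" "\<And>w. w \<in> set_pmf M \<Longrightarrow> g w \<le> h w"
  shows "expect M g \<le> expect M h"
  unfolding expect_finite[OF assms(1)] using assms by (intro sum_mono mult_right_mono) auto

lemma expect_cong:
  assumes "\<And>w. w \<in> set_pmf M \<Longrightarrow> g w = h w"
  shows "expect M g = expect M h"
  using assms by (intro integral_cong_AE) (auto simp: AE_measure_pmf_iff)

lemma expect_add:
  "finite (set_pmf M) \<Longrightarrow> expect M (\<lambda>w. g w + h w) = expect M g + expect M h"
  by (intro Bochner_Integration.integral_add integrable_measure_pmf_finite)

lemma expect_diff:
  "finite (set_pmf M) \<Longrightarrow> expect M (\<lambda>w. g w - h w) = expect M g - expect M h"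
  by (intro Bochner_Integration.integral_diff integrable_measure_pmf_finite)

lemma expect_sum:
  "finite (set_pmf M) \<Longrightarrow> expect M (\<lambda>w. \<Sum>x\<in>X. g x w) = (\<Sum>x\<in>X. expect M (g x))"
  by (intro Bochner_Integration.integral_sum integrable_measure_pmf_finite)

lemma prob_finite:
  assumes "finite (set_pmf M)"
  shows "measure_pmf.prob M {u. B u} = (\<Sum>u\<in>set_pmf M. of_bool (B u) * pmf M u)"
proof -
  have "measure_pmf.prob M {u. B u} = measure_pmf.prob M ({u. B u} \<inter> set_pmf M)"
    by (simp add: measure_Int_set_pmf)
  also have "\<dots> = (\<Sum>u\<in>{u. B u} \<inter> set_pmf M. pmf M u)"
    using assms by (intro measure_measure_pmf_finite) auto
  also have "\<dots> = (\<Sum>u\<in>set_pmf M. of_bool (B u) * pmf M u)"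
    using assms by (intro sum.mono_neutral_cong_left) auto
  finally show ?thesis .
qed

lemma prob_atom_pos:
  assumes "w \<in> set_pmf M"
  shows "measure_pmf.prob M {u. f u = f w} > 0"
  using assms by (intro measure_pmf_posI[of w]) auto

lemma post_nonneg: "post M f B w \<ge> 0"
  by (simp add: post_def)

lemma post_le_one: "post M f B w \<le> 1"
proof -
  have "measure_pmf.prob M {u. B u \<and> f u = f w} \<le> measure_pmf.prob M {u. f u = f w}"
    by (intro measure_pmf.finite_measure_mono) auto
  then show ?thesis by (simp add: post_def divide_le_eq_1 zero_less_measure_iff)
qed

lemma post_pos:
  assumes "w \<in> set_pmf M" "B w"
  shows "post M f B w > 0"
  unfolding post_def using assms prob_atom_pos[OF assms(1), of f]
  by (intro divide_pos_pos measure_pmf_posI[of w]) auto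

lemma post_eq:
  assumes "f u = f w"
  shows "post M f B u = post M f B w"
  using assms by (simp add: post_def)

lemma post_cong:
  assumes "\<And>u. f u = f w \<longleftrightarrow> g u = g w"
  shows "post M f B w = post M g B w"
  using assms by (simp add: post_def)

text \<open>The defining property of conditional expectation. The left side is a sum over pairs of
  outcomes in the same level set; after swapping the sums, \<open>h\<close> and the mass of the
  level set are constant in the inner one, which then adds up to that mass.\<close>

lemma expect_post:
  assumes fin: "finite (set_pmf M)" and h: "\<And>u w. f u = f w \<Longrightarrow> h u = h w"
  shows "expect M (\<lambda>w. h w * post M f B w) = expect M (\<lambda>w. h w * of_bool (B w))"
proof -
  define S where "S = set_pmf M"
  define D where "D = (\<lambda>w. measure_pmf.prob M {u. f u = f w})"
  have D: "D w > 0" if "w \<in> S" for w using that by (simp add: D_def S_def prob_atom_pos)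
  have De: "D w = (\<Sum>u\<in>S. of_bool (f u = f w) * pmf M u)" for w
    by (simp add: D_def prob_finite[OF fin] S_def)
  have "expect M (\<lambda>w. h w * post M f B w)
      = (\<Sum>w\<in>S. \<Sum>u\<in>S. (h w / D w * pmf M w) * (of_bool (B u \<and> f u = f w) * pmf M u))"
    unfolding expect_finite[OF fin] S_def[symmetric]
  proof (intro sum.cong refl)
    fix w
    have "post M f B w = (\<Sum>u\<in>S. of_bool (B u \<and> f u = f w) * pmf M u) / D w"
      unfolding post_def D_def prob_finite[OF fin, of "\<lambda>u. B u \<and> f u = f w"] S_def ..
    then show "h w * post M f B w * pmf M w
        = (\<Sum>u\<in>S. (h w / D w * pmf M w) * (of_bool (B u \<and> f u = f w) * pmf M u))"
      unfolding sum_distrib_left[symmetric] by simp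
  qed
  also have "\<dots> = (\<Sum>u\<in>S. \<Sum>w\<in>S. (h w / D w * pmf M w) * (of_bool (B u \<and> f u = f w) * pmf M u))"
    by (rule sum.swap)
  also have "\<dots> = (\<Sum>u\<in>S. (h u * of_bool (B u) * pmf M u))"
  proof (intro sum.cong refl)
    fix u assume u: "u \<in> S"
    have "(\<Sum>w\<in>S. (h w / D w * pmf M w) * (of_bool (B u \<and> f u = f w) * pmf M u))
        = (\<Sum>w\<in>S. (h u / D u * of_bool (B u) * pmf M u) * (of_bool (f w = f u) * pmf M w))"
    proof (intro sum.cong refl)
      fix w
      show "(h w / D w * pmf M w) * (of_bool (B u \<and> f u = f w) * pmf M u)
          = (h u / D u * of_bool (B u) * pmf M u) * (of_bool (f w = f u) * pmf M w)"
      proof (cases "f w = f u")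
        case True
        then have "h w = h u" "D w = D u" using h[of w u] by (auto simp: D_def)
        then show ?thesis using True by simp
      qed auto
    qed
    also have "\<dots> = (h u / D u * of_bool (B u) * pmf M u) * D u"
      by (simp add: De sum_distrib_left)
    finally show "(\<Sum>w\<in>S. (h w / D w * pmf M w) * (of_bool (B u \<and> f u = f w) * pmf M u))
        = h u * of_bool (B u) * pmf M u" using D[OF u] by simp
  qed
  finally show ?thesis by (simp add: expect_finite[OF fin] S_def)
qed

lemma expect_post_refine:
  assumes fin: "finite (set_pmf M)" and h: "\<And>u w. f u = f w \<Longrightarrow> h u = h w"
    and ref: "\<And>u w. f' u = f' w \<Longrightarrow> f u = f w"
  shows "expect M (\<lambda>w. h w * post M f' B w) = expect M (\<lambda>w. h w * post M f B w)"
proof -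
  have "expect M (\<lambda>w. h w * post M f' B w) = expect M (\<lambda>w. h w * of_bool (B w))"
    by (rule expect_post[OF fin]) (rule h, rule ref)
  also have "\<dots> = expect M (\<lambda>w. h w * post M f B w)"
    by (rule expect_post[OF fin, symmetric]) (rule h)
  finally show ?thesis .
qed

text \<open>Splitting by the value of \<open>Z\<close> leaves indicators multiplied by functions of
  \<open>f\<close>, and \<open>expect_post\<close> turns these indicators into posteriors.\<close>

lemma expect_disintegrate:
  assumes fin: "finite (set_pmf M)" and X: "finite X" "Z ` set_pmf M \<subseteq> X"
    and g: "\<And>u w x. f u = f w \<Longrightarrow> g u x = g w x"
  shows "expect M (\<lambda>w. g w (Z w)) = (\<Sum>x\<in>X. expect M (\<lambda>w. g w x * post M f (\<lambda>u. Z u = x) w))"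
proof -
  have "expect M (\<lambda>w. g w (Z w)) = expect M (\<lambda>w. \<Sum>x\<in>X. g w x * of_bool (Z w = x))"
    using X by (intro expect_cong) (auto simp: of_bool_def if_distrib cong: if_cong)
  also have "\<dots> = (\<Sum>x\<in>X. expect M (\<lambda>w. g w x * of_bool (Z w = x)))"
    by (rule expect_sum[OF fin])
  also have "\<dots> = (\<Sum>x\<in>X. expect M (\<lambda>w. g w x * post M f (\<lambda>u. Z u = x) w))"
    by (intro sum.cong refl expect_post[OF fin, symmetric] g)
  finally show ?thesis .
qed

lemma sum_post:
  assumes fin: "finite (set_pmf M)" and X: "finite X" "Z ` set_pmf M \<subseteq> X" and w: "w \<in> set_pmf M"
  shows "(\<Sum>x\<in>X. post M f (\<lambda>u. Z u = x) w) = 1"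
proof -
  have "(\<Sum>x\<in>X. measure_pmf.prob M {u. Z u = x \<and> f u = f w})
      = (\<Sum>x\<in>X. \<Sum>u\<in>set_pmf M. of_bool (Z u = x \<and> f u = f w) * pmf M u)"
    by (simp add: prob_finite[OF fin])
  also have "\<dots> = (\<Sum>u\<in>set_pmf M. \<Sum>x\<in>X. of_bool (Z u = x \<and> f u = f w) * pmf M u)"
    by (rule sum.swap)
  also have "\<dots> = (\<Sum>u\<in>set_pmf M. of_bool (f u = f w) * pmf M u)"
  proof (intro sum.cong refl)
    fix u assume "u \<in> set_pmf M"
    then have "Z u \<in> X" using X by auto
    have "(\<Sum>x\<in>X. of_bool (Z u = x \<and> f u = f w) * pmf M u)
        = (\<Sum>x\<in>X. if Z u = x then of_bool (f u = f w) * pmf M u else 0)"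
      by (intro sum.cong) auto
    then show "(\<Sum>x\<in>X. of_bool (Z u = x \<and> f u = f w) * pmf M u) = of_bool (f u = f w) * pmf M u"
      using \<open>Z u \<in> X\<close> X by simp
  qed
  also have "\<dots> = measure_pmf.prob M {u. f u = f w}" by (simp add: prob_finite[OF fin])
  finally show ?thesis using prob_atom_pos[OF w, of f]
    by (simp add: post_def sum_divide_distrib[symmetric])
qed

text \<open>Pythagoras for a martingale step: the finer posterior averages to the coarser one on
  each coarse level set, so the cross term equals the coarser second moment.\<close>

lemma expect_post_diff_square:
  assumes fin: "finite (set_pmf M)" and ref: "\<And>u w. f' u = f' w \<Longrightarrow> f u = f w"
  shows "expect M (\<lambda>w. (post M f' B w - post M f B w)\<^sup>2)
    = expect M (\<lambda>w. (post M f' B w)\<^sup>2) - expect M (\<lambda>w. (post M f B w)\<^sup>2)"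
proof -
  have "expect M (\<lambda>w. post M f B w * post M f' B w) = expect M (\<lambda>w. post M f B w * post M f B w)"
    by (rule expect_post_refine[OF fin post_eq ref])
  moreover have "expect M (\<lambda>w. (post M f' B w - post M f B w)\<^sup>2)
    = expect M (\<lambda>w. (post M f' B w)\<^sup>2 + (post M f B w)\<^sup>2
        - (post M f B w * post M f' B w + post M f B w * post M f' B w))"
    by (intro expect_cong) (simp add: power2_eq_square algebra_simps)
  ultimately show ?thesis
    unfolding expect_add[OF fin] expect_diff[OF fin] by (simp add: power2_eq_square)
qed

lemma post_energy_diff:
  assumes "finite (set_pmf M)" "\<And>u w. f' u = f' w \<Longrightarrow> f u = f w"
  shows "(\<Sum>x\<in>X. expect M (\<lambda>w. (post M f' (\<lambda>u. Z u = x) w - post M f (\<lambda>u. Z u = x) w)\<^sup>2))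
    = post_energy X M f' Z - post_energy X M f Z"
  by (simp add: post_energy_def sum_subtractf[symmetric] expect_post_diff_square[OF assms])

lemma post_energy_mono:
  assumes "finite (set_pmf M)" "\<And>u w. f' u = f' w \<Longrightarrow> f u = f w"
  shows "post_energy X M f Z \<le> post_energy X M f' Z"
proof -
  have "0 \<le> (\<Sum>x\<in>X. expect M (\<lambda>w. (post M f' (\<lambda>u. Z u = x) w - post M f (\<lambda>u. Z u = x) w)\<^sup>2))"
    by (intro sum_nonneg integral_nonneg) auto
  then show ?thesis by (simp add: post_energy_diff[OF assms])
qed

lemma post_energy_nonneg: "post_energy X M f Z \<ge> 0"
  unfolding post_energy_def by (intro sum_nonneg integral_nonneg) auto

lemma post_energy_le_one:
  assumes fin: "finite (set_pmf M)" and X: "finite X" "Z ` set_pmf M \<subseteq> X"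
  shows "post_energy X M f Z \<le> 1"
proof -
  have "post_energy X M f Z \<le> (\<Sum>x\<in>X. expect M (\<lambda>w. post M f (\<lambda>u. Z u = x) w))"
    unfolding post_energy_def
    by (intro sum_mono expect_mono[OF fin]) (simp add: power2_eq_square mult_left_le post_nonneg post_le_one)
  also have "\<dots> = expect M (\<lambda>w. \<Sum>x\<in>X. post M f (\<lambda>u. Z u = x) w)"
    by (rule expect_sum[OF fin, symmetric])
  also have "\<dots> = expect M (\<lambda>w. 1)" by (intro expect_cong sum_post[OF fin X])
  finally show ?thesis by simp
qed

lemma sum_expect_post_centered_square:
  assumes fin: "finite (set_pmf M)" and X: "finite X" "X \<noteq> {}" "Z ` set_pmf M \<subseteq> X"
  shows "(\<Sum>x\<in>X. expect M (\<lambda>w. (post M f (\<lambda>u. Z u = x) w - 1 / card X)\<^sup>2))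
     = post_energy X M f Z - 1 / card X"
proof -
  define c where "c = real (card X)"
  have c: "c > 0" using X by (simp add: c_def card_gt_0_iff)
  have "(\<Sum>x\<in>X. expect M (\<lambda>w. (post M f (\<lambda>u. Z u = x) w - 1 / c)\<^sup>2))
      = expect M (\<lambda>w. \<Sum>x\<in>X. (post M f (\<lambda>u. Z u = x) w - 1 / c)\<^sup>2)"
    by (rule expect_sum[OF fin, symmetric])
  also have "\<dots> = expect M (\<lambda>w. (\<Sum>x\<in>X. (post M f (\<lambda>u. Z u = x) w)\<^sup>2) - 1 / c)"
  proof (rule expect_cong)
    fix w assume w: "w \<in> set_pmf M"
    define q where "q = (\<lambda>x. post M f (\<lambda>u. Z u = x) w)"
    have "(\<Sum>x\<in>X. (q x - 1 / c)\<^sup>2) = (\<Sum>x\<in>X. (q x)\<^sup>2 - 2 / c * q x + 1 / c\<^sup>2)"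
      by (intro sum.cong refl) (simp add: power2_eq_square algebra_simps)
    also have "\<dots> = (\<Sum>x\<in>X. (q x)\<^sup>2) - 2 / c * sum q X + c * (1 / c\<^sup>2)"
      by (simp only: sum.distrib sum_subtractf sum_distrib_left[symmetric]) (simp add: c_def)
    also have "sum q X = 1" unfolding q_def by (rule sum_post[OF fin X(1,3) w])
    finally show "(\<Sum>x\<in>X. (post M f (\<lambda>u. Z u = x) w - 1 / c)\<^sup>2)
        = (\<Sum>x\<in>X. (post M f (\<lambda>u. Z u = x) w)\<^sup>2) - 1 / c"
      using c by (simp add: q_def power2_eq_square)
  qed
  also have "\<dots> = (\<Sum>x\<in>X. expect M (\<lambda>w. (post M f (\<lambda>u. Z u = x) w)\<^sup>2)) - 1 / c"
    by (simp add: expect_diff[OF fin] expect_sum[OF fin])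
  finally show ?thesis by (simp add: post_energy_def c_def)
qed

section \<open>Monotonicity and chain rule for the information\<close>

lemma info_eq_kl:
  assumes fin: "finite (set_pmf M)" and X: "finite X" "Z ` set_pmf M \<subseteq> X"
  shows "info (card X) M f Z = expect M (\<lambda>w. kl_unif X (\<lambda>x. post M f (\<lambda>u. Z u = x) w))"
proof -
  have "info (card X) M f Z
      = (\<Sum>x\<in>X. expect M (\<lambda>w. ln (card X * post M f (\<lambda>u. Z u = x) w) * post M f (\<lambda>u. Z u = x) w))"
    unfolding info_def
    by (rule expect_disintegrate[OF fin X, where g = "\<lambda>w x. ln (card X * post M f (\<lambda>u. Z u = x) w)" and f = f])
      (simp add: post_def)
  also have "\<dots> = expect M (\<lambda>w. \<Sum>x\<in>X. ln (card X * post M f (\<lambda>u. Z u = x) w) * post M f (\<lambda>u. Z u = x) w)"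
    by (rule expect_sum[OF fin, symmetric])
  finally show ?thesis by (simp add: kl_unif_def mult.commute)
qed

text \<open>Disintegration multiplies the quotient by its denominator and leaves the total mass of
  \<open>g\<close>. Only an inequality holds, since a colour of posterior zero contributes 0 even
  where \<open>g\<close> is positive. Combined with ln x \<le> x - 1 this is Gibbs'
  inequality.\<close>

lemma expect_ratio_le_one:
  assumes fin: "finite (set_pmf M)" and X: "finite X" "Z ` set_pmf M \<subseteq> X"
    and g: "\<And>u w x. f u = f w \<Longrightarrow> g u x = g w x"
    and g0: "\<And>w x. w \<in> set_pmf M \<Longrightarrow> g w x \<ge> 0"
    and g1: "\<And>w. w \<in> set_pmf M \<Longrightarrow> (\<Sum>x\<in>X. g w x) \<le> 1"
  shows "expect M (\<lambda>w. g w (Z w) / post M f (\<lambda>u. Z u = Z w) w) \<le> 1"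
proof -
  have g': "g u x / post M f (\<lambda>u. Z u = x) u = g w x / post M f (\<lambda>u. Z u = x) w"
    if "f u = f w" for u w x
    using post_eq[of f u w M "\<lambda>u. Z u = x"] g[of u w x] that by simp
  have "expect M (\<lambda>w. g w (Z w) / post M f (\<lambda>u. Z u = Z w) w)
      = (\<Sum>x\<in>X. expect M (\<lambda>w. g w x / post M f (\<lambda>u. Z u = x) w * post M f (\<lambda>u. Z u = x) w))"
    by (rule expect_disintegrate[OF fin X, where g = "\<lambda>w x. g w x / post M f (\<lambda>u. Z u = x) w" and f = f])
      (rule g')
  also have "\<dots> \<le> (\<Sum>x\<in>X. expect M (\<lambda>w. g w x))"
    using g0 by (intro sum_mono expect_mono[OF fin]) auto
  also have "\<dots> = expect M (\<lambda>w. \<Sum>x\<in>X. g w x)" by (rule expect_sum[OF fin, symmetric])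
  also have "\<dots> \<le> expect M (\<lambda>w. 1)" by (rule expect_mono[OF fin g1])
  finally show ?thesis by simp
qed

text \<open>The difference is the mean of the logarithm of coarse over fine posterior; it is
  nonpositive by \<open>expect_ratio_le_one\<close>, with the coarse posterior as numerator.\<close>

lemma info_mono:
  assumes fin: "finite (set_pmf M)" and X: "finite X" "Z ` set_pmf M \<subseteq> X" and r: "r > 0"
    and ref: "\<And>u w. f' u = f' w \<Longrightarrow> f u = f w"
  shows "info r M f Z \<le> info r M f' Z"
proof -
  define p where "p = (\<lambda>w. post M f (\<lambda>u. Z u = Z w) w)"
  define p' where "p' = (\<lambda>w. post M f' (\<lambda>u. Z u = Z w) w)"
  have "info r M f Z - info r M f' Z = expect M (\<lambda>w. ln (r * p w) - ln (r * p' w))"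
    unfolding info_def p_def p'_def by (rule expect_diff[OF fin, symmetric])
  also have "\<dots> \<le> expect M (\<lambda>w. p w / p' w - 1)"
  proof (rule expect_mono[OF fin])
    fix w assume w: "w \<in> set_pmf M"
    then have "p w > 0" "p' w > 0" by (auto simp: p_def p'_def intro!: post_pos)
    then show "ln (r * p w) - ln (r * p' w) \<le> p w / p' w - 1"
      using ln_le_minus_one[of "p w / p' w"] r by (simp add: ln_mult ln_div)
  qed
  also have "\<dots> = expect M (\<lambda>w. p w / p' w) - 1"
    by (simp add: expect_diff[OF fin])
  also have "expect M (\<lambda>w. p w / p' w) \<le> 1"
    unfolding p_def p'_def
    by (rule expect_ratio_le_one[OF fin X, where g = "\<lambda>w x. post M f (\<lambda>u. Z u = x) w" and f = f'])
      (simp_all add: post_nonneg sum_post[OF fin X], rule post_eq, rule ref)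
  finally show ?thesis by simp
qed

text \<open>With \<open>k\<close> the law of \<open>Y\<close> given \<open>f\<close> and
  \<open>Z\<close>, and \<open>m\<close> its law given \<open>f\<close> alone, the increase is the
  mean of ln (k / m). Exchanging \<open>m\<close> for any fixed law \<open>R\<close> adds the mean
  of ln (R / m), which is nonpositive, so the bound may use a reference law that ignores
  \<open>f\<close>.\<close>

lemma info_chain_step:
  fixes Y :: "'w \<Rightarrow> 'c::finite"
  assumes fin: "finite (set_pmf M)" and r: "r > 0"
    and R0: "\<And>y. R y \<ge> 0" and R1: "sum R UNIV = 1"
    and pos: "\<And>w y. w \<in> set_pmf M \<Longrightarrow> post M (\<lambda>u. (f u, Z u)) (\<lambda>u. Y u = y) w > 0 \<Longrightarrow> R y > 0"
  shows "info r M (\<lambda>u. (f u, Y u)) Z \<le> info r M f Z + expect M (\<lambda>w. \<Sum>y\<in>UNIV.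
     post M (\<lambda>u. (f u, Z u)) (\<lambda>u. Y u = y) w
       * ln (post M (\<lambda>u. (f u, Z u)) (\<lambda>u. Y u = y) w / R y))"
proof -
  define k where "k = (\<lambda>w y. post M (\<lambda>u. (f u, Z u)) (\<lambda>u. Y u = y) w)"
  define m where "m = (\<lambda>w. post M f (\<lambda>u. Y u = Y w) w)"
  have "info r M (\<lambda>u. (f u, Y u)) Z - info r M f Z
      = expect M (\<lambda>w. ln (r * post M (\<lambda>u. (f u, Y u)) (\<lambda>u. Z u = Z w) w)
          - ln (r * post M f (\<lambda>u. Z u = Z w) w))"
    unfolding info_def by (rule expect_diff[OF fin, symmetric])
  also have "\<dots> \<le> expect M (\<lambda>w. ln (k w (Y w) / R (Y w)) + (R (Y w) / m w - 1))"
  proof (rule expect_mono[OF fin])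
    fix w assume w: "w \<in> set_pmf M"
    define a where "a = post M (\<lambda>u. (f u, Y u)) (\<lambda>u. Z u = Z w) w"
    define b where "b = post M f (\<lambda>u. Z u = Z w) w"
    have pos': "a > 0" "b > 0" "k w (Y w) > 0" "m w > 0"
      using w by (auto simp: a_def b_def k_def m_def intro!: post_pos)
    have Rp: "R (Y w) > 0" using pos[OF w] pos'(3) by (simp add: k_def)
    \<comment> \<open>Bayes' rule: both products are the joint posterior of the actual values of
      \<open>Y\<close> and \<open>Z\<close> given \<open>f\<close>.\<close>
    have "a * m w = k w (Y w) * b"
    proof -
      have "measure_pmf.prob M {u. f u = f w} > 0"
        "measure_pmf.prob M {u. f u = f w \<and> Y u = Y w} > 0"
        "measure_pmf.prob M {u. f u = f w \<and> Z u = Z w} > 0"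
        using w by (auto intro!: measure_pmf_posI[of w])
      then show ?thesis
        by (simp add: a_def m_def k_def b_def post_def conj_ac field_simps)
    qed
    then have "ln (a * m w) = ln (k w (Y w) * b)" by simp
    then have "ln (r * a) - ln (r * b) = ln (k w (Y w)) - ln (m w)"
      using pos' r by (simp add: ln_mult)
    also have "\<dots> = ln (k w (Y w) / R (Y w)) + ln (R (Y w) / m w)"
      using pos' Rp by (simp add: ln_div)
    also have "\<dots> \<le> ln (k w (Y w) / R (Y w)) + (R (Y w) / m w - 1)"
      using pos' Rp by (intro add_left_mono ln_le_minus_one) auto
    finally show "ln (r * post M (\<lambda>u. (f u, Y u)) (\<lambda>u. Z u = Z w) w)
          - ln (r * post M f (\<lambda>u. Z u = Z w) w) \<le> ln (k w (Y w) / R (Y w)) + (R (Y w) / m w - 1)"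
      by (simp add: a_def b_def)
  qed
  also have "\<dots> = expect M (\<lambda>w. ln (k w (Y w) / R (Y w))) + (expect M (\<lambda>w. R (Y w) / m w) - 1)"
    by (simp add: expect_add[OF fin] expect_diff[OF fin])
  also have "expect M (\<lambda>w. R (Y w) / m w) \<le> 1"
    unfolding m_def
    by (rule expect_ratio_le_one[OF fin, where X = UNIV and g = "\<lambda>w. R"]) (auto simp: R0 R1)
  also have "expect M (\<lambda>w. ln (k w (Y w) / R (Y w)))
      = (\<Sum>y\<in>UNIV. expect M (\<lambda>w. ln (k w y / R y) * k w y))"
    unfolding k_def
    by (rule expect_disintegrate[OF fin, where g = "\<lambda>w y. ln (k w y / R y)" and f = "\<lambda>u. (f u, Z u)", unfolded k_def])
      (simp_all add: post_def)
  also have "\<dots> = expect M (\<lambda>w. \<Sum>y\<in>UNIV. k w y * ln (k w y / R y))"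
    by (simp add: expect_sum[OF fin] mult.commute)
  finally show ?thesis by (simp add: k_def)
qed

lemma post_map_pmf: "post (map_pmf T M) f B (T w) = post M (f \<circ> T) (B \<circ> T) w"
  by (simp add: post_def vimage_def)

lemma info_map_pmf: "info r (map_pmf T M) f Z = info r M (f \<circ> T) (Z \<circ> T)"
  by (simp add: info_def post_map_pmf comp_def)

lemma post_energy_map_pmf: "post_energy X (map_pmf T M) f Z = post_energy X M (f \<circ> T) (Z \<circ> T)"
  by (simp add: post_energy_def post_map_pmf comp_def)

lemma info_cong:
  assumes "\<And>u w. f u = f w \<longleftrightarrow> g u = g w"
  shows "info r M f Z = info r M g Z"
proof -
  have "post M f B w = post M g B w" for B w by (rule post_cong) (rule assms)
  then show ?thesis by (simp add: info_def)
qed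

lemma post_energy_cong:
  assumes "\<And>u w. f u = f w \<longleftrightarrow> g u = g w"
  shows "post_energy X M f Z = post_energy X M g Z"
proof -
  have "post M f B w = post M g B w" for B w by (rule post_cong) (rule assms)
  then show ?thesis by (simp add: post_energy_def)
qed

lemma post_energy_le_info:
  assumes fin: "finite (set_pmf M)" and X: "finite X" "X \<noteq> {}" "Z ` set_pmf M \<subseteq> X"
  shows "post_energy X M f Z - 1 / card X \<le> 2 * info (card X) M f Z"
proof -
  have "post_energy X M f Z - 1 / card X
      = expect M (\<lambda>w. (\<Sum>x\<in>X. (post M f (\<lambda>u. Z u = x) w)\<^sup>2) - 1 / card X)"
    by (simp add: post_energy_def expect_diff[OF fin] expect_sum[OF fin])
  also have "\<dots> \<le> expect M (\<lambda>w. 2 * kl_unif X (\<lambda>x. post M f (\<lambda>u. Z u = x) w))"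
    by (intro expect_mono[OF fin] sum_square_le_kl_unif X sum_post[OF fin X(1,3)] post_nonneg)
  finally show ?thesis by (simp add: info_eq_kl[OF fin X(1,3)])
qed

section \<open>The block model on unordered pairs\<close>

text \<open>Unordered pairs let vertex permutations act by images; the order i < j would not be
  preserved.\<close>

definition pairs :: "'v set \<Rightarrow> 'v set set" where
  "pairs V = {e. e \<subseteq> V \<and> card e = 2}"

lemma finite_pairs: "finite V \<Longrightarrow> finite (pairs V)"
  by (rule finite_subset[of _ "Pow V"]) (auto simp: pairs_def)

lemma pairs_mono: "V \<subseteq> W \<Longrightarrow> pairs V \<subseteq> pairs W"
  by (auto simp: pairs_def)

lemma image_pairs:
  assumes "inj \<pi>"
  shows "(`) \<pi> ` pairs V = pairs (\<pi> ` V)"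
proof
  show "(`) \<pi> ` pairs V \<subseteq> pairs (\<pi> ` V)"
    using assms by (auto simp: pairs_def card_image inj_on_subset)
  show "pairs (\<pi> ` V) \<subseteq> (`) \<pi> ` pairs V"
  proof
    fix e assume e: "e \<in> pairs (\<pi> ` V)"
    then obtain e' where e': "e' \<subseteq> V" "e = \<pi> ` e'" by (auto simp: pairs_def subset_image_iff)
    then have "card e' = card e" using assms by (simp add: card_image inj_on_subset)
    then have "e' \<in> pairs V" using e e' by (auto simp: pairs_def)
    then show "e \<in> (`) \<pi> ` pairs V" using e' by blast
  qed
qed

lemma pairs_insert:
  assumes "\<rho> \<notin> V"
  shows "pairs (insert \<rho> V) = pairs V \<union> (\<lambda>w. {\<rho>, w}) ` V"
proof
  show "pairs V \<union> (\<lambda>w. {\<rho>, w}) ` V \<subseteq> pairs (insert \<rho> V)"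
    using assms by (auto simp: pairs_def card_insert_if)
  show "pairs (insert \<rho> V) \<subseteq> pairs V \<union> (\<lambda>w. {\<rho>, w}) ` V"
  proof
    fix e assume e: "e \<in> pairs (insert \<rho> V)"
    then obtain i j where ij: "e = {i, j}" "i \<noteq> j" by (auto simp: pairs_def card_2_iff)
    show "e \<in> pairs V \<union> (\<lambda>w. {\<rho>, w}) ` V"
      using e ij by (auto simp: pairs_def insert_commute)
  qed
qed

text \<open>\<open>A\<close> is an arbitrary set of pairs, so that edges can be revealed singly.
  Restriction fixes the values elsewhere, hence two observations coincide iff the outcomes agree on
  \<open>A\<close> and \<open>S\<close>.\<close>

definition observe :: "'v set set \<Rightarrow> 'v set \<Rightarrow> ('v \<Rightarrow> nat) \<times> ('v set \<Rightarrow> 'c)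
    \<Rightarrow> ('v set \<Rightarrow> 'c) \<times> ('v \<Rightarrow> nat)" where
  "observe A S w = (restrict (snd w) A, restrict (fst w) S)"

lemma observe_eq_iff:
  "observe A S u = observe A S w \<longleftrightarrow> (\<forall>e\<in>A. snd u e = snd w e) \<and> (\<forall>i\<in>S. fst u i = fst w i)"
  by (auto simp: observe_def restrict_def fun_eq_iff)

lemma observe_mono:
  assumes "A \<subseteq> A'" "S \<subseteq> S'" "observe A' S' u = observe A' S' w"
  shows "observe A S u = observe A S w"
  using assms by (auto simp: observe_eq_iff)

section \<open>Product laws and their reindexing\<close>

lemma prob_pair_pmf_Times:
  "measure_pmf.prob (pair_pmf M N) (A \<times> B) = measure_pmf.prob M A * measure_pmf.prob N B"
proof -
  have "measure_pmf.prob (pair_pmf M N) (A \<times> B)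
      = measure_pmf.prob (pair_pmf M N) ((A \<times> B) \<inter> set_pmf (pair_pmf M N))"
    by (rule measure_Int_set_pmf[symmetric])
  also have "(A \<times> B) \<inter> set_pmf (pair_pmf M N) = (A \<inter> set_pmf M) \<times> (B \<inter> set_pmf N)" by auto
  also have "measure_pmf.prob (pair_pmf M N) \<dots>
      = measure_pmf.prob M (A \<inter> set_pmf M) * measure_pmf.prob N (B \<inter> set_pmf N)"
    by (rule measure_pmf_prob_product) auto
  finally show ?thesis by (simp add: measure_Int_set_pmf)
qed

text \<open>Serves both the vertex permutations and the passage between ordered and unordered pairs.
  As \<open>h\<close> matters on \<open>A\<close> only, the default is restored explicitly
  elsewhere.\<close>

lemma Pi_pmf_reindex:
  assumes "finite A" "bij_betw h A B"
  shows "map_pmf (\<lambda>g x. if x \<in> A then g (h x) else d) (Pi_pmf B d p) = Pi_pmf A d (p \<circ> h)"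
  using assms
proof (induction A arbitrary: B rule: finite_induct)
  case empty
  then have "B = {}" by (auto simp: bij_betw_def)
  then show ?case by simp
next
  case (insert x A)
  define B' where "B' = h ` A"
  have inj: "inj_on h (insert x A)" and B: "B = insert (h x) B'"
    using insert.prems by (auto simp: bij_betw_def B'_def)
  have B': "finite B'" "h x \<notin> B'" "bij_betw h A B'"
    using inj insert.hyps by (auto simp: B'_def bij_betw_def)
  have hx: "h z \<noteq> h x" if "z \<in> A" for z
    using B'(2) that unfolding B'_def by (metis imageI)
  have "map_pmf (\<lambda>g z. if z \<in> insert x A then g (h z) else d) (Pi_pmf B d p)
      = map_pmf (\<lambda>(y, g). (\<lambda>z. if z \<in> A then g (h z) else d)(x := y)) (pair_pmf (p (h x)) (Pi_pmf B' d p))"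
    unfolding B Pi_pmf_insert[OF B'(1,2)] map_pmf_comp
    using hx insert.hyps by (intro map_pmf_cong refl) (auto simp: fun_eq_iff)
  also have "\<dots> = map_pmf (\<lambda>(y, g). g(x := y)) (pair_pmf (p (h x))
      (map_pmf (\<lambda>g z. if z \<in> A then g (h z) else d) (Pi_pmf B' d p)))"
    by (simp add: pair_map_pmf2 map_pmf_comp case_prod_unfold)
  also have "\<dots> = Pi_pmf (insert x A) d (p \<circ> h)"
    unfolding insert.IH[OF B'(3)] by (simp add: Pi_pmf_insert[OF insert.hyps])
  finally show ?case .
qed

lemma Pi_pmf_comp_bij:
  assumes "finite B" and h: "bij h" and img: "h ` A = B"
  shows "map_pmf (\<lambda>g. g \<circ> h) (Pi_pmf B d p) = Pi_pmf A d (p \<circ> h)"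
proof -
  have finA: "finite A" using assms by (metis bij_is_inj finite_imageD inj_on_subset subset_UNIV)
  have bb: "bij_betw h A B" using h img by (metis bij_betw_subset subset_UNIV)
  have mem: "h x \<in> B \<longleftrightarrow> x \<in> A" for x using img h by (metis bij_is_inj inj_image_mem_iff)
  have "map_pmf (\<lambda>g. g \<circ> h) (Pi_pmf B d p) = map_pmf (\<lambda>g x. if x \<in> A then g (h x) else d) (Pi_pmf B d p)"
  proof (intro map_pmf_cong refl)
    fix g assume "g \<in> set_pmf (Pi_pmf B d p)"
    then have "g z = d" if "z \<notin> B" for z using that set_Pi_pmf_subset[OF assms(1)] by fastforce
    then show "g \<circ> h = (\<lambda>x. if x \<in> A then g (h x) else d)" by (auto simp: fun_eq_iff mem)
  qed
  then show ?thesis by (simp add: Pi_pmf_reindex[OF finA bb])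
qed

section \<open>The model, its marginals and its symmetries\<close>

locale block_model =
  fixes r :: nat and P Q :: "'c::finite pmf" and d :: 'c
  assumes r2: "r \<ge> 2"
begin

text \<open>On a pair, the image is a singleton iff the two colours agree. This needs no order of
  the endpoints and is visibly invariant under injective renaming of the colours.\<close>

definition kernel :: "('v \<Rightarrow> nat) \<Rightarrow> 'v set \<Rightarrow> 'c pmf" where
  "kernel \<sigma> e = (if card (\<sigma> ` e) = 1 then P else Q)"

definition colours :: "'v set \<Rightarrow> ('v \<Rightarrow> nat) pmf" where
  "colours V = Pi_pmf V 0 (\<lambda>_. pmf_of_set {1..r})"

definition graph :: "'v set \<Rightarrow> ('v \<Rightarrow> nat) \<Rightarrow> ('v set \<Rightarrow> 'c) pmf" where
  "graph V \<sigma> = Pi_pmf (pairs V) d (kernel \<sigma>)"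

definition model :: "'v set \<Rightarrow> (('v \<Rightarrow> nat) \<times> ('v set \<Rightarrow> 'c)) pmf" where
  "model V = bind_pmf (colours V) (\<lambda>\<sigma>. map_pmf (Pair \<sigma>) (graph V \<sigma>))"

lemma colour_range: "finite {1..r}" "{1..r} \<noteq> {}" "card {1..r} = r"
  using r2 by auto

lemma finite_set_colours: "finite V \<Longrightarrow> finite (set_pmf (colours V))"
  using r2 by (auto simp: colours_def set_Pi_pmf intro!: finite_PiE_dflt)

lemma finite_set_graph: "finite V \<Longrightarrow> finite (set_pmf (graph V \<sigma>))"
  by (auto simp: graph_def set_Pi_pmf finite_pairs intro!: finite_PiE_dflt)

lemma finite_set_model: "finite V \<Longrightarrow> finite (set_pmf (model V))"
  by (auto simp: model_def finite_set_colours finite_set_graph)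

lemma colours_in_range:
  assumes "finite V" "\<sigma> \<in> set_pmf (colours V)" "i \<in> V"
  shows "\<sigma> i \<in> {1..r}"
  using assms colour_range by (auto simp: colours_def set_Pi_pmf PiE_dflt_def)

lemma model_in_range:
  assumes "finite V" "i \<in> V"
  shows "(\<lambda>w. fst w i) ` set_pmf (model V) \<subseteq> {1..r}"
  using colours_in_range[OF assms(1) _ assms(2)] by (auto simp: model_def)

lemma expect_model:
  assumes "finite V"
  shows "expect (model V) h = expect (colours V) (\<lambda>\<sigma>. expect (graph V \<sigma>) (\<lambda>G. h (\<sigma>, G)))"
proof -
  have "expect (model V) h = (\<Sum>\<sigma>\<in>set_pmf (colours V). pmf (colours V) \<sigma> *\<^sub>R
      expect (map_pmf (Pair \<sigma>) (graph V \<sigma>)) h)"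
    unfolding model_def
    by (rule pmf_expectation_bind) (use assms in \<open>auto simp: finite_set_colours finite_set_graph\<close>)
  then show ?thesis
    by (simp add: expect_finite[OF finite_set_colours[OF assms]] mult.commute)
qed

text \<open>Given the colours, the label at \<open>e\<close> is independent of all other labels, and
  \<open>B\<close> does not look at that label.\<close>

lemma prob_model_edge:
  assumes V: "finite V" and e: "e \<in> pairs V"
    and B: "\<And>\<sigma> G z. B (\<sigma>, G(e := z)) = B (\<sigma>, G)"
  shows "measure_pmf.prob (model V) {w. snd w e = y \<and> B w}
    = expect (model V) (\<lambda>w. pmf (kernel (fst w) e) y * of_bool (B w))"
proof -
  have fin: "finite (set_pmf (model V))" by (rule finite_set_model[OF V])
  have inner: "expect (graph V \<sigma>) (\<lambda>G. of_bool (G e = y \<and> B (\<sigma>, G)))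
      = expect (graph V \<sigma>) (\<lambda>G. pmf (kernel \<sigma> e) y * of_bool (B (\<sigma>, G)))" for \<sigma>
  proof -
    define N where "N = Pi_pmf (pairs V - {e}) d (kernel \<sigma>)"
    have ins: "insert e (pairs V - {e}) = pairs V" using e by auto
    have g: "graph V \<sigma> = map_pmf (\<lambda>(y, f). f(e := y)) (pair_pmf (kernel \<sigma> e) N)"
      unfolding graph_def N_def
      by (subst ins[symmetric], rule Pi_pmf_insert) (auto simp: finite_pairs V)
    have 1: "measure_pmf.prob (graph V \<sigma>) {G. G e = y \<and> B (\<sigma>, G)}
        = measure_pmf.prob (pair_pmf (kernel \<sigma> e) N) ({y} \<times> {f. B (\<sigma>, f)})"
      unfolding g by (auto simp: B intro!: arg_cong2[where f = measure])
    have 2: "measure_pmf.prob (graph V \<sigma>) {G. B (\<sigma>, G)}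
        = measure_pmf.prob (pair_pmf (kernel \<sigma> e) N) (UNIV \<times> {f. B (\<sigma>, f)})"
      unfolding g by (auto simp: B intro!: arg_cong2[where f = measure])
    have ind: "expect (graph V \<sigma>) (\<lambda>G. of_bool (H G)) = measure_pmf.prob (graph V \<sigma>) {G. H G}" for H
      by (simp add: expect_finite prob_finite finite_set_graph[OF V])
    show ?thesis
      by (simp add: ind 1 2 prob_pair_pmf_Times measure_pmf_single)
  qed
  have "measure_pmf.prob (model V) {w. snd w e = y \<and> B w}
      = expect (model V) (\<lambda>w. of_bool (snd w e = y \<and> B w))"
    by (simp add: expect_finite[OF fin] prob_finite[OF fin])
  also have "\<dots> = expect (model V) (\<lambda>w. pmf (kernel (fst w) e) y * of_bool (B w))"
    unfolding expect_model[OF V] fst_conv snd_conv inner ..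
  finally show ?thesis .
qed

lemma kernel_pair: "kernel \<sigma> {i, j} = (if \<sigma> i = \<sigma> j then P else Q)"
  by (auto simp: kernel_def card_insert_if)

text \<open>Since \<rho> belongs to \<open>S\<close>, its colour is constant on the level set, so
  the label has law \<open>P\<close> or \<open>Q\<close> according to whether \<open>v\<close> has
  that known colour. Averaging over the colour of \<open>v\<close> gives the mixture.\<close>

lemma post_edge:
  assumes V: "finite V" and e: "{\<rho>, v} \<in> pairs V" and A: "{\<rho>, v} \<notin> A" and S: "\<rho> \<in> S"
    and w: "w \<in> set_pmf (model V)"
  shows "post (model V) (observe A S) (\<lambda>u. snd u {\<rho>, v} = y) w
    = edge_law P Q (post (model V) (observe A S) (\<lambda>u. fst u v = fst w \<rho>) w) y"
proof -
  define M where "M = model V"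
  have fin: "finite (set_pmf M)" unfolding M_def by (rule finite_set_model[OF V])
  define D where "D = measure_pmf.prob M {u. observe A S u = observe A S w}"
  have D: "D > 0" using w by (simp add: D_def M_def prob_atom_pos)
  have "measure_pmf.prob M {u. snd u {\<rho>, v} = y \<and> observe A S u = observe A S w}
      = expect M (\<lambda>u. pmf (kernel (fst u) {\<rho>, v}) y * of_bool (observe A S u = observe A S w))"
    unfolding M_def by (rule prob_model_edge[OF V e]) (use A in \<open>auto simp: observe_eq_iff\<close>)
  also have "\<dots> = expect M (\<lambda>u. pmf Q y * of_bool (observe A S u = observe A S w)
      + (pmf P y - pmf Q y) * of_bool (fst u v = fst w \<rho> \<and> observe A S u = observe A S w))"
    using S by (intro expect_cong) (auto simp: kernel_pair observe_eq_iff)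
  also have "\<dots> = pmf Q y * D + (pmf P y - pmf Q y)
      * measure_pmf.prob M {u. fst u v = fst w \<rho> \<and> observe A S u = observe A S w}"
    unfolding expect_add[OF fin] D_def
    by (simp add: expect_finite[OF fin] prob_finite[OF fin])
  finally show ?thesis using D
    by (simp add: post_def M_def[symmetric] D_def[symmetric] edge_law_def field_simps)
qed

text \<open>Forgetting a vertex leaves the smaller model, independent of the forgotten uniform
  colour. Its coordinates are reset to the defaults 0 and \<open>d\<close>, so that the result is
  literally an outcome of the smaller model.\<close>

lemma model_insert:
  assumes V: "finite V" and \<rho>: "\<rho> \<notin> V"
  shows "map_pmf (\<lambda>(\<sigma>, G). (\<sigma> \<rho>, (\<sigma>(\<rho> := 0), \<lambda>e. if e \<in> pairs V then G e else d)))
      (model (insert \<rho> V)) = pair_pmf (pmf_of_set {1..r}) (model V)"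
proof -
  have c: "colours (insert \<rho> V)
      = map_pmf (\<lambda>(x, \<sigma>). \<sigma>(\<rho> := x)) (pair_pmf (pmf_of_set {1..r}) (colours V))"
    unfolding colours_def by (rule Pi_pmf_insert[OF V \<rho>])
  have g: "map_pmf (\<lambda>G e. if e \<in> pairs V then G e else d) (graph (insert \<rho> V) (\<sigma>(\<rho> := x))) = graph V \<sigma>"
    for \<sigma> x
  proof -
    have "map_pmf (\<lambda>G e. if e \<in> pairs V then G e else d) (graph (insert \<rho> V) (\<sigma>(\<rho> := x)))
        = Pi_pmf (pairs V) d (kernel (\<sigma>(\<rho> := x)))"
      unfolding graph_def
      by (rule Pi_pmf_subset[symmetric]) (auto simp: V finite_pairs intro: pairs_mono[THEN subsetD, of V])
    also have "\<dots> = graph V \<sigma>"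
      unfolding graph_def
    proof (rule Pi_pmf_cong[OF refl refl])
      fix e assume "e \<in> pairs V"
      then have "\<rho> \<notin> e" using \<rho> by (auto simp: pairs_def)
      then have "(\<sigma>(\<rho> := x)) ` e = \<sigma> ` e" by (auto simp: image_def)
      then show "kernel (\<sigma>(\<rho> := x)) e = kernel \<sigma> e" by (simp add: kernel_def)
    qed
    finally show ?thesis .
  qed
  have "map_pmf (\<lambda>(\<sigma>, G). (\<sigma> \<rho>, (\<sigma>(\<rho> := 0), \<lambda>e. if e \<in> pairs V then G e else d))) (model (insert \<rho> V))
      = bind_pmf (pmf_of_set {1..r}) (\<lambda>x. bind_pmf (colours V) (\<lambda>\<sigma>.
          map_pmf (\<lambda>G. (x, (\<sigma>(\<rho> := 0), G)))
            (map_pmf (\<lambda>G e. if e \<in> pairs V then G e else d) (graph (insert \<rho> V) (\<sigma>(\<rho> := x))))))"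
    unfolding model_def c map_bind_pmf bind_map_pmf pair_pmf_def bind_assoc_pmf bind_return_pmf
    by (simp add: map_pmf_comp o_def)
  also have "\<dots> = bind_pmf (pmf_of_set {1..r}) (\<lambda>x. bind_pmf (colours V) (\<lambda>\<sigma>.
          map_pmf (\<lambda>G. (x, (\<sigma>, G))) (graph V \<sigma>)))"
  proof (intro bind_pmf_cong refl)
    fix x \<sigma> assume "\<sigma> \<in> set_pmf (colours V)"
    then have "\<sigma> \<rho> = 0" using \<rho> V set_Pi_pmf_subset[OF V] unfolding colours_def by fastforce
    then have "\<sigma>(\<rho> := 0) = \<sigma>" by auto
    then show "map_pmf (\<lambda>G. (x, (\<sigma>(\<rho> := 0), G)))
            (map_pmf (\<lambda>G e. if e \<in> pairs V then G e else d) (graph (insert \<rho> V) (\<sigma>(\<rho> := x))))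
        = map_pmf (\<lambda>G. (x, (\<sigma>, G))) (graph V \<sigma>)" by (simp add: g)
  qed
  also have "\<dots> = pair_pmf (pmf_of_set {1..r}) (model V)"
    by (simp add: pair_pmf_def model_def bind_assoc_pmf bind_map_pmf bind_return_pmf map_pmf_def)
  finally show ?thesis .
qed

lemma post_colour_indep:
  assumes V: "finite V" and \<rho>: "\<rho> \<in> V" and A: "A \<subseteq> pairs (V - {\<rho>})" and S: "S \<subseteq> V - {\<rho>}"
    and w: "w \<in> set_pmf (model V)" and x: "x \<in> {1..r}"
  shows "post (model V) (observe A S) (\<lambda>u. fst u \<rho> = x) w = 1 / r"
proof -
  define W where "W = V - {\<rho>}"
  define f where "f = (\<lambda>(\<sigma>::'a \<Rightarrow> nat, G). (\<sigma> \<rho>, (\<sigma>(\<rho> := 0), \<lambda>e. if e \<in> pairs W then G e else d)))"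
  have W: "finite W" "\<rho> \<notin> W" "insert \<rho> W = V" using V \<rho> by (auto simp: W_def)
  have map: "map_pmf f (model V) = pair_pmf (pmf_of_set {1..r}) (model W)"
    using model_insert[OF W(1,2)] unfolding f_def W(3) .
  have obs: "observe A S (snd (f u)) = observe A S u" for u
    using A S by (auto simp: observe_eq_iff f_def W_def split: prod.splits)
  have fst_f: "fst (f u) = fst u \<rho>" for u by (simp add: f_def split: prod.splits)
  have "measure_pmf.prob (model V) {u. fst u \<rho> = x \<and> observe A S u = observe A S w}
      = measure_pmf.prob (map_pmf f (model V)) ({x} \<times> {u. observe A S u = observe A S w})"
    unfolding measure_map_pmf
    by (rule arg_cong2[where f = measure]) (simp_all add: vimage_def mem_Times_iff obs fst_f)
  also have "\<dots> = 1 / r * measure_pmf.prob (model W) {u. observe A S u = observe A S w}"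
    using x r2 by (simp add: map prob_pair_pmf_Times measure_pmf_single)
  also have "measure_pmf.prob (model W) {u. observe A S u = observe A S w}
      = measure_pmf.prob (map_pmf f (model V)) (UNIV \<times> {u. observe A S u = observe A S w})"
    by (simp add: map prob_pair_pmf_Times)
  also have "\<dots> = measure_pmf.prob (model V) {u. observe A S u = observe A S w}"
    unfolding measure_map_pmf
    by (rule arg_cong2[where f = measure]) (simp_all add: vimage_def mem_Times_iff obs)
  finally show ?thesis using prob_atom_pos[OF w, of "observe A S"] by (simp add: post_def)
qed

text \<open>Consistency of the marginals: it allows models of different sizes to be compared when
  the additional vertices are not observed.\<close>

lemma post_energy_insert_vertex:
  assumes V: "finite V" and \<rho>: "\<rho> \<notin> V" and A: "A \<subseteq> pairs V" and S: "S \<subseteq> V" and i: "i \<in> V"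
  shows "post_energy X (model (insert \<rho> V)) (observe A S) (\<lambda>w. fst w i)
    = post_energy X (model V) (observe A S) (\<lambda>w. fst w i)"
proof -
  define f where "f = (\<lambda>(\<sigma>::'a \<Rightarrow> nat, G). (\<sigma>(\<rho> := 0), \<lambda>e. if e \<in> pairs V then G e else d))"
  have "model V = map_pmf snd (pair_pmf (pmf_of_set {1..r}) (model V))" by (simp add: map_snd_pair_pmf)
  also have "\<dots> = map_pmf f (model (insert \<rho> V))"
    unfolding model_insert[OF V \<rho>, symmetric] by (simp add: map_pmf_comp f_def o_def case_prod_unfold)
  finally have m: "model V = map_pmf f (model (insert \<rho> V))" .
  have obs: "observe A S (f u) = observe A S u" for u
    using A S \<rho> by (auto simp: observe_eq_iff f_def split: prod.splits)
  have "fst (f u) i = fst u i" for u using i \<rho> by (auto simp: f_def split: prod.splits)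
  then show ?thesis unfolding m post_energy_map_pmf by (simp add: o_def obs)
qed

lemma model_permute:
  assumes V: "finite V" and \<pi>: "bij \<pi>" "\<pi> ` V = V"
  shows "map_pmf (\<lambda>(\<sigma>, G). (\<sigma> \<circ> \<pi>, G \<circ> (`) \<pi>)) (model V) = model V"
proof -
  have bij: "bij ((`) \<pi>)"
    by (metis \<pi>(1) bij_betw_Pow Pow_UNIV)
  have img: "(`) \<pi> ` pairs V = pairs V" using image_pairs[of \<pi> V] \<pi> by (simp add: bij_is_inj)
  have g: "map_pmf (\<lambda>G. G \<circ> (`) \<pi>) (graph V \<sigma>) = graph V (\<sigma> \<circ> \<pi>)" for \<sigma>
    unfolding graph_def
    by (subst Pi_pmf_comp_bij[OF finite_pairs[OF V] bij img])
      (auto simp: kernel_def image_comp comp_def intro!: Pi_pmf_cong)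
  have c: "map_pmf (\<lambda>\<sigma>. \<sigma> \<circ> \<pi>) (colours V) = colours V"
    unfolding colours_def by (subst Pi_pmf_comp_bij[OF V \<pi>]) (simp add: o_def)
  have "map_pmf (\<lambda>(\<sigma>, G). (\<sigma> \<circ> \<pi>, G \<circ> (`) \<pi>)) (model V)
      = bind_pmf (colours V) (\<lambda>\<sigma>. map_pmf (Pair (\<sigma> \<circ> \<pi>)) (map_pmf (\<lambda>G. G \<circ> (`) \<pi>) (graph V \<sigma>)))"
    by (simp add: model_def map_bind_pmf map_pmf_comp o_def)
  also have "\<dots> = bind_pmf (map_pmf (\<lambda>\<sigma>. \<sigma> \<circ> \<pi>) (colours V)) (\<lambda>\<sigma>. map_pmf (Pair \<sigma>) (graph V \<sigma>))"
    by (simp add: g bind_map_pmf)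
  finally show ?thesis by (simp add: c model_def)
qed

lemma observe_permute_iff:
  "(observe A S \<circ> (\<lambda>(\<sigma>, G). (\<sigma> \<circ> \<pi>, G \<circ> (`) \<pi>))) u = (observe A S \<circ> (\<lambda>(\<sigma>, G). (\<sigma> \<circ> \<pi>, G \<circ> (`) \<pi>))) w
    \<longleftrightarrow> observe ((`) \<pi> ` A) (\<pi> ` S) u = observe ((`) \<pi> ` A) (\<pi> ` S) w"
  by (cases u; cases w) (auto simp: observe_eq_iff)

lemma info_permute:
  assumes "finite V" "bij \<pi>" "\<pi> ` V = V"
  shows "info r (model V) (observe (pairs T) S) (\<lambda>w. fst w i)
    = info r (model V) (observe (pairs (\<pi> ` T)) (\<pi> ` S)) (\<lambda>w. fst w (\<pi> i))"
proof -
  define f where "f = (\<lambda>(\<sigma>::'a \<Rightarrow> nat, G::'a set \<Rightarrow> 'c). (\<sigma> \<circ> \<pi>, G \<circ> (`) \<pi>))"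
  have "info r (model V) (observe (pairs T) S) (\<lambda>w. fst w i)
      = info r (map_pmf f (model V)) (observe (pairs T) S) (\<lambda>w. fst w i)"
    unfolding f_def model_permute[OF assms] ..
  also have "\<dots> = info r (model V) (observe (pairs T) S \<circ> f) (\<lambda>w. fst w (\<pi> i))"
    unfolding info_map_pmf by (simp add: f_def o_def case_prod_unfold)
  also have "\<dots> = info r (model V) (observe (pairs (\<pi> ` T)) (\<pi> ` S)) (\<lambda>w. fst w (\<pi> i))"
    unfolding f_def image_pairs[OF bij_is_inj[OF assms(2)], symmetric]
    by (rule info_cong) (rule observe_permute_iff)
  finally show ?thesis .
qed

lemma post_energy_permute:
  assumes "finite V" "bij \<pi>" "\<pi> ` V = V"
  shows "post_energy X (model V) (observe (pairs T) S) (\<lambda>w. fst w i)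
    = post_energy X (model V) (observe (pairs (\<pi> ` T)) (\<pi> ` S)) (\<lambda>w. fst w (\<pi> i))"
proof -
  define f where "f = (\<lambda>(\<sigma>::'a \<Rightarrow> nat, G::'a set \<Rightarrow> 'c). (\<sigma> \<circ> \<pi>, G \<circ> (`) \<pi>))"
  have "post_energy X (model V) (observe (pairs T) S) (\<lambda>w. fst w i)
      = post_energy X (map_pmf f (model V)) (observe (pairs T) S) (\<lambda>w. fst w i)"
    unfolding f_def model_permute[OF assms] ..
  also have "\<dots> = post_energy X (model V) (observe (pairs T) S \<circ> f) (\<lambda>w. fst w (\<pi> i))"
    unfolding post_energy_map_pmf by (simp add: f_def o_def case_prod_unfold)
  also have "\<dots> = post_energy X (model V) (observe (pairs (\<pi> ` T)) (\<pi> ` S)) (\<lambda>w. fst w (\<pi> i))"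
    unfolding f_def image_pairs[OF bij_is_inj[OF assms(2)], symmetric]
    by (rule post_energy_cong) (rule observe_permute_iff)
  finally show ?thesis .
qed

text \<open>Only equality of colours influences the graph, so swapping two colours preserves the
  model. Hence the graph is independent of the colour of any single vertex.\<close>

lemma prob_colour_graph:
  assumes V: "finite V" and v: "v \<in> V" and y: "y \<in> {1..r}"
  shows "measure_pmf.prob (model V) {w. fst w v = y \<and> H (snd w)}
    = measure_pmf.prob (model V) {w. H (snd w)} / r"
proof -
  define p where "p = (\<lambda>y. measure_pmf.prob (model V) {w. fst w v = y \<and> H (snd w)})"
  have eq: "p z = p y" if z: "z \<in> {1..r}" for z
  proof -
    define t where "t = Transposition.transpose y z"
    \<comment> \<open>Real colours start at 1; the swap must fix 0, the default value outside
      \<open>V\<close>.\<close>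
    have t0: "t 0 = 0" using y z by (simp add: t_def)
    have inj: "inj t" by (simp add: t_def)
    have tr: "bij_betw t {1..r} {1..r}" 
      using y z inj by (intro bij_betw_imageI) (auto simp: t_def inj_on_subset)
    have c: "map_pmf ((\<circ>) t) (colours V) = colours V"
    proof -
      have "map_pmf ((\<circ>) t) (colours V) = Pi_pmf V (t 0) (\<lambda>x. map_pmf t (pmf_of_set {1..r}))"
        unfolding colours_def t0 by (subst Pi_pmf_map[OF V, of t 0 0]) (auto simp: t0)
      also have "map_pmf t (pmf_of_set {1..r}) = pmf_of_set {1..r}"
        using map_pmf_of_set_bij_betw[OF tr] colour_range by simp
      finally show ?thesis unfolding t0 colours_def .
    qed
    have k: "kernel (t \<circ> \<sigma>) = kernel \<sigma>" for \<sigma> :: "'a \<Rightarrow> nat"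
    proof
      fix e
      have "card ((t \<circ> \<sigma>) ` e) = card (\<sigma> ` e)"
        using inj by (metis card_image image_comp inj_on_subset subset_UNIV)
      then show "kernel (t \<circ> \<sigma>) e = kernel \<sigma> e" by (simp add: kernel_def)
    qed
    have "map_pmf (\<lambda>(\<sigma>, G). (t \<circ> \<sigma>, G)) (model V)
        = bind_pmf (colours V) (\<lambda>\<sigma>. map_pmf (Pair (t \<circ> \<sigma>)) (graph V (t \<circ> \<sigma>)))"
      by (simp add: model_def map_bind_pmf map_pmf_comp graph_def k)
    also have "\<dots> = bind_pmf (map_pmf ((\<circ>) t) (colours V)) (\<lambda>\<sigma>. map_pmf (Pair \<sigma>) (graph V \<sigma>))"
      by (simp add: bind_map_pmf)
    finally have "map_pmf (\<lambda>(\<sigma>, G). (t \<circ> \<sigma>, G)) (model V) = model V" by (simp add: c model_def)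
    then have "p z = measure_pmf.prob (map_pmf (\<lambda>(\<sigma>, G). (t \<circ> \<sigma>, G)) (model V)) {w. fst w v = z \<and> H (snd w)}"
      by (simp add: p_def)
    also have "\<dots> = p y"
      unfolding p_def measure_map_pmf
      by (rule arg_cong2[where f = measure]) (auto simp: t_def transpose_eq_iff)
    finally show ?thesis .
  qed
  have fin: "finite (set_pmf (model V))" by (rule finite_set_model[OF V])
  have "measure_pmf.prob (model V) {w. H (snd w)} = expect (model V) (\<lambda>w. of_bool (H (snd w)))"
    by (simp add: expect_finite[OF fin] prob_finite[OF fin])
  also have "\<dots> = expect (model V) (\<lambda>w. \<Sum>z\<in>{1..r}. of_bool (fst w v = z \<and> H (snd w)))"
  proof (rule expect_cong)
    fix w assume "w \<in> set_pmf (model V)"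
    then have "fst w v \<in> {1..r}" using model_in_range[OF V v] by auto
    then show "of_bool (H (snd w)) = (\<Sum>z\<in>{1..r}. of_bool (fst w v = z \<and> H (snd w)) :: real)"
      by (simp add: of_bool_conj sum_distrib_right[symmetric] of_bool_def)
  qed
  also have "\<dots> = (\<Sum>z\<in>{1..r}. expect (model V) (\<lambda>w. of_bool (fst w v = z \<and> H (snd w))))"
    by (rule expect_sum[OF fin])
  also have "\<dots> = (\<Sum>z\<in>{1..r}. p z)"
    by (simp add: p_def expect_finite[OF fin] prob_finite[OF fin])
  also have "\<dots> = r * p y" by (simp add: eq)
  finally show ?thesis using r2 by (simp add: p_def)
qed

end

section \<open>The information recursion\<close>

context block_model
begin

definition vinfo :: "'v set \<Rightarrow> 'v set set \<Rightarrow> 'v set \<Rightarrow> 'v \<Rightarrow> real" where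
  "vinfo V A S i = info r (model V) (observe A S) (\<lambda>w. fst w i)"

definition venergy :: "'v set \<Rightarrow> 'v set set \<Rightarrow> 'v set \<Rightarrow> 'v \<Rightarrow> real" where
  "venergy V A S i = post_energy {1..r} (model V) (observe A S) (\<lambda>w. fst w i)"

lemma vinfo_reveal_edge:
  assumes V: "finite V" and e: "{\<rho>, v} \<in> pairs V" and A: "{\<rho>, v} \<notin> A"
  shows "vinfo V (insert {\<rho>, v} A) S \<rho> \<le> vinfo V A S \<rho> + expect (model V) (\<lambda>w.
    edge_kl r P Q (post (model V) (observe A (insert \<rho> S)) (\<lambda>u. fst u v = fst w \<rho>) w))"
proof -
  define M where "M = model V"
  define R where "R = edge_avg r P Q"
  have fin: "finite (set_pmf M)" unfolding M_def by (rule finite_set_model[OF V])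
  have cond: "post M (\<lambda>u. (observe A S u, fst u \<rho>)) (\<lambda>u. snd u {\<rho>, v} = y) w
      = edge_law P Q (post M (observe A (insert \<rho> S)) (\<lambda>u. fst u v = fst w \<rho>) w) y"
    if "w \<in> set_pmf M" for w y
  proof -
    have "post M (\<lambda>u. (observe A S u, fst u \<rho>)) (\<lambda>u. snd u {\<rho>, v} = y) w
        = post M (observe A (insert \<rho> S)) (\<lambda>u. snd u {\<rho>, v} = y) w"
      by (rule post_cong) (auto simp: observe_eq_iff)
    also have "\<dots> = edge_law P Q (post M (observe A (insert \<rho> S)) (\<lambda>u. fst u v = fst w \<rho>) w) y"
      unfolding M_def by (rule post_edge[OF V e A]) (use that in \<open>auto simp: M_def\<close>)
    finally show ?thesis .
  qed
  have "vinfo V (insert {\<rho>, v} A) S \<rho> = info r M (\<lambda>u. (observe A S u, snd u {\<rho>, v})) (\<lambda>u. fst u \<rho>)"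
    unfolding vinfo_def M_def by (rule info_cong) (auto simp: observe_eq_iff)
  also have "\<dots> \<le> info r M (observe A S) (\<lambda>u. fst u \<rho>) + expect M (\<lambda>w. \<Sum>y\<in>UNIV.
     post M (\<lambda>u. (observe A S u, fst u \<rho>)) (\<lambda>u. snd u {\<rho>, v} = y) w
       * ln (post M (\<lambda>u. (observe A S u, fst u \<rho>)) (\<lambda>u. snd u {\<rho>, v} = y) w / R y))"
  proof (rule info_chain_step[OF fin])
    show "r > 0" using r2 by simp
    show "R y \<ge> 0" for y unfolding R_def edge_avg_def using r2 by (intro edge_law_nonneg) auto
    show "sum R UNIV = 1" by (simp add: R_def edge_avg_def sum_edge_law)
    show "R y > 0" if "w \<in> set_pmf M"
      "post M (\<lambda>u. (observe A S u, fst u \<rho>)) (\<lambda>u. snd u {\<rho>, v} = y) w > 0" for w y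
      using edge_avg_pos[OF r2] that(2) unfolding R_def cond[OF that(1)] by (metis less_irrefl)
  qed
  also have "expect M (\<lambda>w. \<Sum>y\<in>UNIV.
     post M (\<lambda>u. (observe A S u, fst u \<rho>)) (\<lambda>u. snd u {\<rho>, v} = y) w
       * ln (post M (\<lambda>u. (observe A S u, fst u \<rho>)) (\<lambda>u. snd u {\<rho>, v} = y) w / R y))
    = expect M (\<lambda>w. edge_kl r P Q (post M (observe A (insert \<rho> S)) (\<lambda>u. fst u v = fst w \<rho>) w))"
    by (rule expect_cong) (simp add: cond edge_kl_def R_def)
  finally show ?thesis by (simp add: vinfo_def M_def)
qed

lemma vinfo_isolated:
  assumes V: "finite V" and \<rho>: "\<rho> \<in> V" and A: "A \<subseteq> pairs (V - {\<rho>})" and S: "S \<subseteq> V - {\<rho>}"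
  shows "vinfo V A S \<rho> = 0"
proof -
  have "vinfo V A S \<rho> = expect (model V) (\<lambda>w. 0)"
    unfolding vinfo_def info_def
  proof (rule expect_cong)
    fix w assume w: "w \<in> set_pmf (model V)"
    then have "fst w \<rho> \<in> {1..r}" using model_in_range[OF V \<rho>] by auto
    then show "ln (r * post (model V) (observe A S) (\<lambda>u. fst u \<rho> = fst w \<rho>) w) = 0"
      using post_colour_indep[OF V \<rho> A S w] r2 by simp
  qed
  then show ?thesis by simp
qed

text \<open>
  The posterior given \<open>T\<close> alone does not depend on the colour of \<open>\<rho>\<close>, so averaging \<open>g\<close> over that
  colour produces a relative entropy; replacing the refined posterior by it costs an increment of
  \<open>venergy\<close>.
\<close>

lemma expect_contract:
  assumes V: "finite V" and \<rho>: "\<rho> \<in> V" and T: "T \<subseteq> V - {\<rho>}" and S: "S \<subseteq> T" and v: "v \<in> T"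
    and A: "pairs T \<subseteq> A" "A \<subseteq> pairs (insert \<rho> T)"
    and g: "\<And>p q. p \<in> {0..1} \<Longrightarrow> q \<in> {0..1} \<Longrightarrow> g p \<le> g q + \<eta> + C * (p - q)\<^sup>2"
    and kl: "\<And>q :: nat \<Rightarrow> real. (\<And>x. x \<in> {1..r} \<Longrightarrow> q x \<ge> 0) \<Longrightarrow> sum q {1..r} = 1
      \<Longrightarrow> (\<Sum>x\<in>{1..r}. g (q x)) \<le> r * kl_unif {1..r} q"
    and C: "C \<ge> 0"
  shows "expect (model V) (\<lambda>w. g (post (model V) (observe A (insert \<rho> S)) (\<lambda>u. fst u v = fst w \<rho>) w))
    \<le> vinfo V (pairs T) S v + \<eta>
      + C * (venergy V (pairs (insert \<rho> T)) (insert \<rho> S) v - venergy V (pairs T) S v)"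
proof -
  define M where "M = model V"
  have fin: "finite (set_pmf M)" unfolding M_def by (rule finite_set_model[OF V])
  define p where "p = (\<lambda>x. post M (observe A (insert \<rho> S)) (\<lambda>u. fst u v = x))"
  define q where "q = (\<lambda>x. post M (observe (pairs T) S) (\<lambda>u. fst u v = x))"
  have vV: "v \<in> V" using v T by auto
  have ran: "(\<lambda>w. fst w v) ` set_pmf M \<subseteq> {1..r}" unfolding M_def by (rule model_in_range[OF V vV])
  have ran\<rho>: "(\<lambda>w. fst w \<rho>) ` set_pmf M \<subseteq> {1..r}" unfolding M_def by (rule model_in_range[OF V \<rho>])
  have pq: "p x w \<in> {0..1}" "q x w \<in> {0..1}" for x w
    by (auto simp: p_def q_def post_nonneg post_le_one)
  have ref: "observe (pairs T) S u = observe (pairs T) S w"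
    if "observe A (insert \<rho> S) u = observe A (insert \<rho> S) w" for u w
    using observe_mono[OF A(1) _ that, of S] by auto
  have ref': "observe A (insert \<rho> S) u = observe A (insert \<rho> S) w"
    if "observe (pairs (insert \<rho> T)) (insert \<rho> S) u = observe (pairs (insert \<rho> T)) (insert \<rho> S) w" for u w
    using observe_mono[OF A(2) _ that, of "insert \<rho> S"] by auto
  have "expect M (\<lambda>w. g (p (fst w \<rho>) w))
      \<le> expect M (\<lambda>w. g (q (fst w \<rho>) w) + (\<eta> + C * (\<Sum>x\<in>{1..r}. (p x w - q x w)\<^sup>2)))"
  proof (rule expect_mono[OF fin])
    fix w assume "w \<in> set_pmf M"
    then have "fst w \<rho> \<in> {1..r}" using ran\<rho> by auto
    \<comment> \<open>The colour of \<rho> is correlated with the refined posterior, so its single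
      term is bounded by the sum over all colours, whose mean is an energy difference.\<close>
    then have "(p (fst w \<rho>) w - q (fst w \<rho>) w)\<^sup>2 \<le> (\<Sum>x\<in>{1..r}. (p x w - q x w)\<^sup>2)"
      by (intro member_le_sum[of _ _ "\<lambda>x. (p x w - q x w)\<^sup>2"]) auto
    then have "C * (p (fst w \<rho>) w - q (fst w \<rho>) w)\<^sup>2 \<le> C * (\<Sum>x\<in>{1..r}. (p x w - q x w)\<^sup>2)"
      using C by (rule mult_left_mono)
    then show "g (p (fst w \<rho>) w) \<le> g (q (fst w \<rho>) w) + (\<eta> + C * (\<Sum>x\<in>{1..r}. (p x w - q x w)\<^sup>2))"
      using g[OF pq(1,2), of "fst w \<rho>" w "fst w \<rho>" w] by linarith
  qed
  also have "\<dots> = expect M (\<lambda>w. g (q (fst w \<rho>) w))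
      + (\<eta> + C * (\<Sum>x\<in>{1..r}. expect M (\<lambda>w. (p x w - q x w)\<^sup>2)))"
    by (simp add: expect_add[OF fin] expect_sum[OF fin])
  also have "(\<Sum>x\<in>{1..r}. expect M (\<lambda>w. (p x w - q x w)\<^sup>2))
      = post_energy {1..r} M (observe A (insert \<rho> S)) (\<lambda>w. fst w v) - venergy V (pairs T) S v"
    unfolding p_def q_def venergy_def M_def[symmetric] by (rule post_energy_diff[OF fin ref])
  \<comment> \<open>Passing from \<open>A\<close> to all pairs on \<open>T\<close> and \<rho> makes
    the error independent of which edges have been revealed so far.\<close>
  also have "post_energy {1..r} M (observe A (insert \<rho> S)) (\<lambda>w. fst w v)
      \<le> venergy V (pairs (insert \<rho> T)) (insert \<rho> S) v"
    unfolding venergy_def M_def[symmetric] by (rule post_energy_mono[OF fin ref'])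
  also have "expect M (\<lambda>w. g (q (fst w \<rho>) w)) \<le> vinfo V (pairs T) S v"
  proof -
    have "expect M (\<lambda>w. g (q (fst w \<rho>) w))
        = (\<Sum>x\<in>{1..r}. expect M (\<lambda>w. g (q x w) * post M (observe (pairs T) S) (\<lambda>u. fst u \<rho> = x) w))"
      by (rule expect_disintegrate[OF fin _ ran\<rho>, where g = "\<lambda>w x. g (q x w)"])
        (simp_all add: q_def post_def)
    also have "\<dots> = (\<Sum>x\<in>{1..r}. expect M (\<lambda>w. g (q x w) / r))"
    proof (intro sum.cong refl expect_cong)
      fix x w assume "x \<in> {1..r}" "w \<in> set_pmf M"
      then have "post M (observe (pairs T) S) (\<lambda>u. fst u \<rho> = x) w = 1 / r"
        unfolding M_def using T S pairs_mono[OF T] by (intro post_colour_indep[OF V \<rho>]) auto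
      then show "g (q x w) * post M (observe (pairs T) S) (\<lambda>u. fst u \<rho> = x) w = g (q x w) / r" by simp
    qed
    also have "\<dots> = expect M (\<lambda>w. (\<Sum>x\<in>{1..r}. g (q x w)) / r)"
      by (subst expect_sum[OF fin, symmetric]) (simp add: sum_divide_distrib)
    also have "\<dots> \<le> expect M (\<lambda>w. kl_unif {1..r} (\<lambda>x. q x w))"
    proof (rule expect_mono[OF fin])
      fix w assume w: "w \<in> set_pmf M"
      have "(\<Sum>x\<in>{1..r}. g (q x w)) \<le> r * kl_unif {1..r} (\<lambda>x. q x w)"
      proof (rule kl)
        show "sum (\<lambda>x. q x w) {1..r} = 1" unfolding q_def by (rule sum_post[OF fin _ ran w]) simp
      qed (use pq in auto)
      then show "(\<Sum>x\<in>{1..r}. g (q x w)) / r \<le> kl_unif {1..r} (\<lambda>x. q x w)"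
        using r2 by (simp add: divide_le_eq mult.commute)
    qed
    also have "\<dots> = vinfo V (pairs T) S v"
      using info_eq_kl[OF fin _ ran, of "observe (pairs T) S"] by (simp add: vinfo_def M_def q_def)
    finally show ?thesis .
  qed
  finally show ?thesis using C by (simp add: p_def M_def mult_left_mono)
qed

section \<open>Monotonicity and exchangeability of information and energy\<close>

lemma vinfo_mono:
  assumes "finite V" "i \<in> V" "A \<subseteq> A'" "S \<subseteq> S'"
  shows "vinfo V A S i \<le> vinfo V A' S' i"
  unfolding vinfo_def
  using r2 by (intro info_mono[OF finite_set_model _ model_in_range] observe_mono[OF assms(3,4)])
    (auto simp: assms)

lemma venergy_mono:
  assumes "finite V" "A \<subseteq> A'" "S \<subseteq> S'"
  shows "venergy V A S i \<le> venergy V A' S' i"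
  unfolding venergy_def
  by (intro post_energy_mono finite_set_model observe_mono[OF assms(2,3)]) (auto simp: assms)

lemma venergy_le_one: "finite V \<Longrightarrow> i \<in> V \<Longrightarrow> venergy V A S i \<le> 1"
  unfolding venergy_def by (intro post_energy_le_one finite_set_model model_in_range) auto

lemma venergy_nonneg: "venergy V A S i \<ge> 0"
  by (simp add: venergy_def post_energy_nonneg)

lemma venergy_le_vinfo:
  assumes "finite V" "i \<in> V"
  shows "venergy V A S i - 1 / r \<le> 2 * vinfo V A S i"
  using post_energy_le_info[OF finite_set_model[OF assms(1)] _ _ model_in_range[OF assms], of "observe A S"] r2
  by (simp add: venergy_def vinfo_def)

lemma sum_expect_centered_eq_venergy:
  assumes "finite V" "i \<in> V"
  shows "(\<Sum>x\<in>{1..r}. expect (model V) (\<lambda>w. (post (model V) (observe A S) (\<lambda>u. fst u i = x) w - 1 / r)\<^sup>2))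
     = venergy V A S i - 1 / r"
  using sum_expect_post_centered_square[OF finite_set_model[OF assms(1)] _ _ model_in_range[OF assms], of "observe A S"] r2
  by (simp add: venergy_def)

lemma vinfo_nonneg:
  assumes "finite V" "i \<in> V"
  shows "vinfo V A S i \<ge> 0"
proof -
  have "0 \<le> (\<Sum>x\<in>{1..r}. expect (model V) (\<lambda>w. (post (model V) (observe A S) (\<lambda>u. fst u i = x) w - 1 / r)\<^sup>2))"
    by (intro sum_nonneg integral_nonneg) auto
  then show ?thesis using sum_expect_centered_eq_venergy[OF assms] venergy_le_vinfo[OF assms, of A S] by simp
qed

lemma vinfo_exchange:
  assumes "finite V" "T \<subseteq> V" "S \<subseteq> T" "i \<in> T - S" "j \<in> T - S"
  shows "vinfo V (pairs T) S i = vinfo V (pairs T) S j"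
proof -
  define \<pi> where "\<pi> = Transposition.transpose i j"
  have "i \<in> V" "j \<in> V" using assms by auto
  then have "\<pi> ` T = T" "\<pi> ` S = S" "\<pi> ` V = V" "bij \<pi>" "\<pi> i = j"
    using assms by (simp_all add: \<pi>_def)
  then show ?thesis using info_permute[of V \<pi> T S i] assms(1) by (simp add: vinfo_def)
qed

lemma venergy_exchange:
  assumes "finite V" "T \<subseteq> V" "S \<subseteq> T" "i \<in> T - S" "j \<in> T - S"
  shows "venergy V (pairs T) S i = venergy V (pairs T) S j"
proof -
  define \<pi> where "\<pi> = Transposition.transpose i j"
  have "i \<in> V" "j \<in> V" using assms by auto
  then have "\<pi> ` T = T" "\<pi> ` S = S" "\<pi> ` V = V" "bij \<pi>" "\<pi> i = j"
    using assms by (simp_all add: \<pi>_def)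
  then show ?thesis using post_energy_permute[of V \<pi> "{1..r}" T S i] assms(1) by (simp add: venergy_def)
qed

lemma venergy_pair_exchange:
  assumes "finite V" "i \<in> V" "v \<in> V" "i \<noteq> v" "i' \<in> V" "v' \<in> V" "i' \<noteq> v'"
  shows "venergy V (pairs V) {v} i = venergy V (pairs V) {v'} i'"
proof -
  define \<pi> where "\<pi> = Transposition.transpose v v'"
  have \<pi>: "\<pi> ` V = V" "\<pi> ` {v} = {v'}" "bij \<pi>"
    using assms by (auto simp: \<pi>_def transpose_image_eq)
  have i: "\<pi> i \<in> V - {v'}"
    using \<pi> assms by (metis Diff_iff bij_is_inj image_eqI image_insert image_empty inj_image_mem_iff singletonD singletonI)
  have "venergy V (pairs V) {v} i = venergy V (pairs V) {v'} (\<pi> i)"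
    using post_energy_permute[of V \<pi> "{1..r}" V "{v}" i] assms(1) \<pi> by (simp add: venergy_def)
  also have "\<dots> = venergy V (pairs V) {v'} i'"
    using assms i by (intro venergy_exchange) auto
  finally show ?thesis .
qed

end

section \<open>The recursion with abstract constants\<close>

text \<open>In the application \<alpha> and \<beta> are the total positive and negative parts of
  \<open>P - Q\<close> over the actual labels, \<kappa> is the cost of an absent edge, and \<eta>,
  \<open>C\<close> form the quadratic modulus. The first three depend on n, the last two do
  not.\<close>

locale block_model_bound = block_model +
  fixes \<alpha> \<beta> \<kappa> \<eta> C :: real
  assumes nonneg: "\<alpha> \<ge> 0" "\<beta> \<ge> 0" "\<kappa> \<ge> 0" "\<eta> \<ge> 0" "C \<ge> 0"
    and edge_kl_bound: "\<And>p. 0 \<le> p \<Longrightarrow> p \<le> 1 \<Longrightarrow>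
      edge_kl r P Q p \<le> (\<alpha> * psi_eq r p + \<beta> * psi_neq r p) / r + \<kappa>"
    and psi_eq_modulus:
      "\<And>p q. p \<in> {0..1} \<Longrightarrow> q \<in> {0..1} \<Longrightarrow> psi_eq r p \<le> psi_eq r q + \<eta> + C * (p - q)\<^sup>2"
      "\<And>p. p \<in> {0..1} \<Longrightarrow> psi_eq r p \<le> C"
    and psi_neq_modulus:
      "\<And>p q. p \<in> {0..1} \<Longrightarrow> q \<in> {0..1} \<Longrightarrow> psi_neq r p \<le> psi_neq r q + \<eta> + C * (p - q)\<^sup>2"
      "\<And>p. p \<in> {0..1} \<Longrightarrow> psi_neq r p \<le> C"
begin

definition \<theta> :: real where "\<theta> = (\<alpha> + \<beta>) / r"

lemma theta_nonneg: "\<theta> \<ge> 0"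
  using nonneg by (simp add: \<theta>_def)

text \<open>A neighbour in \<open>S\<close> has a known colour, so nothing contracts and the crude
  bound \<open>C\<close> is used. This is affordable because the number of such neighbours stays
  bounded while \<theta> has order 1/n.\<close>

lemma expect_edge_kl_le:
  assumes V: "finite V" and \<rho>: "\<rho> \<in> V" and T: "T \<subseteq> V - {\<rho>}" and S: "S \<subseteq> T" and v: "v \<in> T"
    and A: "pairs T \<subseteq> A" "A \<subseteq> pairs (insert \<rho> T)"
  shows "expect (model V) (\<lambda>w. edge_kl r P Q
      (post (model V) (observe A (insert \<rho> S)) (\<lambda>u. fst u v = fst w \<rho>) w))
    \<le> (if v \<in> S then \<theta> * C else \<theta> * (vinfo V (pairs T) S v + \<eta>
      + C * (venergy V (pairs (insert \<rho> T)) (insert \<rho> S) v - venergy V (pairs T) S v))) + \<kappa>"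
proof -
  define M where "M = model V"
  have fin: "finite (set_pmf M)" unfolding M_def by (rule finite_set_model[OF V])
  define p where "p = (\<lambda>w. post M (observe A (insert \<rho> S)) (\<lambda>u. fst u v = fst w \<rho>) w)"
  have p: "p w \<in> {0..1}" for w by (auto simp: p_def post_nonneg post_le_one)
  define B where "B = (if v \<in> S then C else vinfo V (pairs T) S v + \<eta>
      + C * (venergy V (pairs (insert \<rho> T)) (insert \<rho> S) v - venergy V (pairs T) S v))"
  have 1: "expect M (\<lambda>w. psi_eq r (p w)) \<le> B"
  proof (cases "v \<in> S")
    case True
    have "expect M (\<lambda>w. psi_eq r (p w)) \<le> expect M (\<lambda>w. C)"
      by (intro expect_mono[OF fin] psi_eq_modulus p)
    then show ?thesis using True by (simp add: B_def)
  next
    case False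
    have "expect M (\<lambda>w. psi_eq r (p w)) \<le> vinfo V (pairs T) S v + \<eta>
      + C * (venergy V (pairs (insert \<rho> T)) (insert \<rho> S) v - venergy V (pairs T) S v)"
      unfolding p_def M_def
      by (rule expect_contract[OF V \<rho> T S v A psi_eq_modulus(1)])
        (use sum_psi_eq[of "{1..r}"] r2 nonneg in auto)
    then show ?thesis using False by (simp add: B_def)
  qed
  have 2: "expect M (\<lambda>w. psi_neq r (p w)) \<le> B"
  proof (cases "v \<in> S")
    case True
    have "expect M (\<lambda>w. psi_neq r (p w)) \<le> expect M (\<lambda>w. C)"
      by (intro expect_mono[OF fin] psi_neq_modulus p)
    then show ?thesis using True by (simp add: B_def)
  next
    case False
    have "expect M (\<lambda>w. psi_neq r (p w)) \<le> vinfo V (pairs T) S v + \<eta>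
      + C * (venergy V (pairs (insert \<rho> T)) (insert \<rho> S) v - venergy V (pairs T) S v)"
      unfolding p_def M_def
      by (rule expect_contract[OF V \<rho> T S v A psi_neq_modulus(1)])
        (use sum_psi_neq_le[of "{1..r}"] r2 nonneg in auto)
    then show ?thesis using False by (simp add: B_def)
  qed
  have "expect M (\<lambda>w. edge_kl r P Q (p w))
      \<le> expect M (\<lambda>w. (\<alpha> * psi_eq r (p w) + \<beta> * psi_neq r (p w)) / r + \<kappa>)"
    using p by (intro expect_mono[OF fin] edge_kl_bound) auto
  also have "\<dots> = (\<alpha> * expect M (\<lambda>w. psi_eq r (p w)) + \<beta> * expect M (\<lambda>w. psi_neq r (p w))) / r + \<kappa>"
    by (simp add: expect_add[OF fin])
  also have "\<dots> \<le> (\<alpha> * B + \<beta> * B) / r + \<kappa>"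
    using 1 2 nonneg by (intro add_right_mono divide_right_mono add_mono mult_left_mono) auto
  also have "(\<alpha> * B + \<beta> * B) / r = \<theta> * B" by (simp add: \<theta>_def algebra_simps)
  finally show ?thesis by (cases "v \<in> S") (simp_all add: p_def M_def B_def)
qed

text \<open>Induction on the set of edges at \<rho> already revealed. It starts at zero, since
  without such an edge the colour of \<rho> is independent of the observation.\<close>

lemma vinfo_new_vertex_le:
  assumes V: "finite V" and \<rho>: "\<rho> \<in> V" and T: "T \<subseteq> V - {\<rho>}" and S: "S \<subseteq> T"
  shows "vinfo V (pairs (insert \<rho> T)) S \<rho> \<le> (\<Sum>v\<in>T. (if v \<in> S then \<theta> * C
      else \<theta> * (vinfo V (pairs T) S v + \<eta>
        + C * (venergy V (pairs (insert \<rho> T)) (insert \<rho> S) v - venergy V (pairs T) S v))) + \<kappa>)"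
proof -
  define b where "b = (\<lambda>v. (if v \<in> S then \<theta> * C
      else \<theta> * (vinfo V (pairs T) S v + \<eta>
        + C * (venergy V (pairs (insert \<rho> T)) (insert \<rho> S) v - venergy V (pairs T) S v))) + \<kappa>)"
  have finT: "finite T" using T V finite_subset by auto
  have \<rho>T: "\<rho> \<notin> T" using T by auto
  have "vinfo V (pairs T \<union> (\<lambda>v. {\<rho>, v}) ` U) S \<rho> \<le> sum b U" if "finite U" "U \<subseteq> T" for U
    using that
  proof (induction U rule: finite_induct)
    case empty
    have "vinfo V (pairs T) S \<rho> = 0"
      using T S pairs_mono[OF T] by (intro vinfo_isolated[OF V \<rho>]) auto
    then show ?case by simp
  next
    case (insert v U)
    define A where "A = pairs T \<union> (\<lambda>v. {\<rho>, v}) ` U"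
    have v: "v \<in> T" using insert by auto
    have "v \<noteq> \<rho>" using v \<rho>T by auto
    then have e: "{\<rho>, v} \<in> pairs V" using v T \<rho> by (auto simp: pairs_def)
    have nA: "{\<rho>, v} \<notin> A"
      using insert \<rho>T by (auto simp: A_def pairs_def doubleton_eq_iff)
    have A: "pairs T \<subseteq> A" "A \<subseteq> pairs (insert \<rho> T)"
      using insert by (auto simp: A_def pairs_insert[OF \<rho>T])
    have "vinfo V (insert {\<rho>, v} A) S \<rho> \<le> vinfo V A S \<rho> + b v"
      using vinfo_reveal_edge[OF V e nA, of S] expect_edge_kl_le[OF V \<rho> T S v A]
      unfolding b_def by linarith
    moreover have "vinfo V A S \<rho> \<le> sum b U" using insert by (simp add: A_def)
    ultimately show ?case using insert.hyps by (simp add: A_def)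
  qed
  from this[OF finT subset_refl] show ?thesis by (simp add: pairs_insert[OF \<rho>T] b_def)
qed

text \<open>Unrevealed vertices are exchangeable, so each contributes the same as \<open>i\<close>.
  The same information then stands on both sides, and the inequality can be solved for it.\<close>

lemma vinfo_recursion:
  assumes V: "finite V" and \<rho>: "\<rho> \<in> V" and T: "T \<subseteq> V - {\<rho>}" and S: "S \<subseteq> T" and i: "i \<in> T - S"
  shows "vinfo V (pairs T) S i \<le> card (T - S) * (\<theta> * (vinfo V (pairs T) S i + \<eta>
      + C * (venergy V (pairs (insert \<rho> T)) (insert \<rho> S) i - venergy V (pairs T) S i)) + \<kappa>)
      + card S * (\<theta> * C + \<kappa>)"
proof -
  have finT: "finite T" using T V finite_subset by auto
  have sub: "insert \<rho> T \<subseteq> V" "T \<subseteq> V" "insert \<rho> S \<subseteq> insert \<rho> T" "\<rho> \<notin> T" using T S \<rho> by auto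
  have "vinfo V (pairs T) S i \<le> vinfo V (pairs (insert \<rho> T)) S i"
    using sub i by (intro vinfo_mono V pairs_mono) auto
  also have "\<dots> = vinfo V (pairs (insert \<rho> T)) S \<rho>"
    using sub i S by (intro vinfo_exchange[OF V]) auto
  also have "\<dots> \<le> (\<Sum>v\<in>T. (if v \<in> S then \<theta> * C
      else \<theta> * (vinfo V (pairs T) S v + \<eta>
        + C * (venergy V (pairs (insert \<rho> T)) (insert \<rho> S) v - venergy V (pairs T) S v))) + \<kappa>)"
    by (rule vinfo_new_vertex_le[OF V \<rho> T S])
  also have "\<dots> = (\<Sum>v\<in>T - S. \<theta> * (vinfo V (pairs T) S v + \<eta>
        + C * (venergy V (pairs (insert \<rho> T)) (insert \<rho> S) v - venergy V (pairs T) S v)) + \<kappa>)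
      + (\<Sum>v\<in>S. \<theta> * C + \<kappa>)"
    by (subst sum.subset_diff[OF S finT]) simp
  also have "(\<Sum>v\<in>T - S. \<theta> * (vinfo V (pairs T) S v + \<eta>
        + C * (venergy V (pairs (insert \<rho> T)) (insert \<rho> S) v - venergy V (pairs T) S v)) + \<kappa>)
     = (\<Sum>v\<in>T - S. \<theta> * (vinfo V (pairs T) S i + \<eta>
        + C * (venergy V (pairs (insert \<rho> T)) (insert \<rho> S) i - venergy V (pairs T) S i)) + \<kappa>)"
  proof (rule sum.cong[OF refl])
    fix v assume v: "v \<in> T - S"
    have "vinfo V (pairs T) S v = vinfo V (pairs T) S i"
      "venergy V (pairs T) S v = venergy V (pairs T) S i"
      using sub v i S V by (auto intro!: vinfo_exchange venergy_exchange)
    moreover have "venergy V (pairs (insert \<rho> T)) (insert \<rho> S) v = venergy V (pairs (insert \<rho> T)) (insert \<rho> S) i"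
      using sub v i S V by (intro venergy_exchange) auto
    ultimately show "\<theta> * (vinfo V (pairs T) S v + \<eta>
        + C * (venergy V (pairs (insert \<rho> T)) (insert \<rho> S) v - venergy V (pairs T) S v)) + \<kappa>
      = \<theta> * (vinfo V (pairs T) S i + \<eta>
        + C * (venergy V (pairs (insert \<rho> T)) (insert \<rho> S) i - venergy V (pairs T) S i)) + \<kappa>" by simp
  qed
  finally show ?thesis by simp
qed

text \<open>
  The \<open>m\<close> extra vertices serve as successive revealed vertices; \<open>venergy\<close> grows by at most \<open>1/m\<close> at one
  of these steps, where the recursion closes.
\<close>

lemma venergy_bound:
  fixes n m :: nat
  assumes n: "n \<ge> 2" and m: "m \<ge> 1" and c: "n * \<theta> \<le> c" "c < 1"
  shows "venergy {..<n} (pairs {..<n}) {n - 1} 0 - 1 / r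
    \<le> 2 / (1 - c) * (c * (\<eta> + C / m) + (n + m) * \<kappa> + m * \<theta> * C)"
proof -
  \<comment> \<open>A single model has room for all \<open>m\<close> extra vertices.
    \<open>T j\<close> contains \<open>j\<close> of them, and \<open>S j\<close> consists of these
    together with the original revealed vertex \<open>n - 1\<close>; the \<open>n - 1\<close>
    unrevealed vertices never change.\<close>
  define V where "V = {..<n + m}"
  define T where "T = (\<lambda>j. {..<n + j})"
  define S where "S = (\<lambda>j. {n - 1..<n + j})"
  define e where "e = (\<lambda>j. venergy V (pairs (T j)) (S j) 0)"
  have V: "finite V" "0 \<in> V" using n by (auto simp: V_def)
  have suc: "insert (n + j) (T j) = T (Suc j)" "insert (n + j) (S j) = S (Suc j)" for j
    using n by (auto simp: T_def S_def)
  have mono: "e i \<le> e j" if "i \<le> j" for i j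
    unfolding e_def using that by (intro venergy_mono V pairs_mono) (auto simp: T_def S_def)
  have "\<exists>j<m. e (Suc j) - e j \<le> 1 / m"
  proof (rule ccontr)
    assume "\<not> ?thesis"
    then have "(\<Sum>j<m. 1 / m) < (\<Sum>j<m. e (Suc j) - e j)"
      using m by (intro sum_strict_mono) (auto simp: not_le lessThan_empty_iff)
    also have "\<dots> = e m - e 0" by (rule sum_lessThan_telescope)
    also have "\<dots> \<le> 1" using venergy_le_one[OF V] venergy_nonneg unfolding e_def by (smt (verit))
    finally show False using m by simp
  qed
  then obtain j where j: "j < m" "e (Suc j) - e j \<le> 1 / m" by blast
  define x where "x = vinfo V (pairs (T j)) (S j) 0"
  have x0: "x \<ge> 0" unfolding x_def by (rule vinfo_nonneg[OF V])
  have cards: "card (T j - S j) = n - 1" "card (S j) = j + 1"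
  proof -
    have "T j - S j = {..<n - 1}" using n by (auto simp: T_def S_def)
    then show "card (T j - S j) = n - 1" by simp
    show "card (S j) = j + 1" using n by (simp add: S_def)
  qed
  have "x \<le> card (T j - S j) * (\<theta> * (x + \<eta> + C * (e (Suc j) - e j)) + \<kappa>) + card (S j) * (\<theta> * C + \<kappa>)"
    unfolding x_def e_def suc[symmetric]
    by (rule vinfo_recursion[OF V(1)]) (use j n in \<open>auto simp: V_def T_def S_def\<close>)
  also have "\<dots> \<le> n * (\<theta> * (x + \<eta> + C / m)) + ((real n - 1) * \<kappa> + (j + 1) * (\<theta> * C + \<kappa>))"
  proof -
    define y where "y = \<theta> * (x + \<eta> + C * (e (Suc j) - e j))"
    have "C * (e (Suc j) - e j) \<le> C * (1 / m)" using j nonneg by (intro mult_left_mono) auto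
    then have "y \<le> \<theta> * (x + \<eta> + C / m)"
      unfolding y_def using theta_nonneg by (intro mult_left_mono) auto
    then have "(real n - 1) * y \<le> (real n - 1) * (\<theta> * (x + \<eta> + C / m))"
      using n by (intro mult_left_mono) auto
    also have "\<dots> \<le> n * (\<theta> * (x + \<eta> + C / m))"
      using x0 nonneg theta_nonneg by (intro mult_right_mono) auto
    finally have "(real n - 1) * y \<le> n * (\<theta> * (x + \<eta> + C / m))" .
    moreover have "card (T j - S j) * (y + \<kappa>) = (real n - 1) * y + (real n - 1) * \<kappa>"
      using n by (simp add: cards of_nat_diff distrib_left)
    moreover have "card (S j) * (\<theta> * C + \<kappa>) = (j + 1) * (\<theta> * C + \<kappa>)" by (simp add: cards)
    ultimately show ?thesis unfolding y_def by linarith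
  qed
  also have "n * (\<theta> * (x + \<eta> + C / m)) \<le> c * (x + \<eta> + C / m)"
  proof -
    have "n * \<theta> * (x + \<eta> + C / m) \<le> c * (x + \<eta> + C / m)"
      using c x0 nonneg by (intro mult_right_mono) auto
    then show ?thesis by (simp add: mult.assoc)
  qed
  also have "(real n - 1) * \<kappa> + (j + 1) * (\<theta> * C + \<kappa>) \<le> (n + m) * \<kappa> + m * \<theta> * C"
  proof -
    have "(real j + 1) * (\<theta> * C + \<kappa>) \<le> m * (\<theta> * C + \<kappa>)"
      using j nonneg theta_nonneg by (intro mult_right_mono) auto
    then show ?thesis using nonneg by (simp add: algebra_simps)
  qed
  finally have "(1 - c) * x \<le> c * (\<eta> + C / m) + (n + m) * \<kappa> + m * \<theta> * C"
    by (simp add: algebra_simps)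
  then have x: "x \<le> (c * (\<eta> + C / m) + (n + m) * \<kappa> + m * \<theta> * C) / (1 - c)"
    using c by (simp add: pos_le_divide_eq mult.commute)
  \<comment> \<open>The extra vertices are removed again one at a time: they are unobserved here and
    do not affect the energy.\<close>
  have "venergy {..<n + k} (pairs {..<n}) {n - 1} 0 = venergy {..<n} (pairs {..<n}) {n - 1} 0" for k
  proof (induction k)
    case (Suc k)
    have "pairs {..<n} \<subseteq> pairs {..<n + k}" by (intro pairs_mono) auto
    then have "venergy (insert (n + k) {..<n + k}) (pairs {..<n}) {n - 1} 0
        = venergy {..<n + k} (pairs {..<n}) {n - 1} 0"
      unfolding venergy_def using n by (intro post_energy_insert_vertex) auto
    then show ?case using Suc by (simp add: lessThan_Suc)
  qed simp
  moreover have S0: "S 0 = {n - 1}" using n by (auto simp: S_def)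
  ultimately have "venergy {..<n} (pairs {..<n}) {n - 1} 0 = e 0"
    using S0 by (simp add: e_def V_def T_def)
  \<comment> \<open>The information is controlled only at the selected step \<open>j\<close>;
    monotonicity of the energy transports the bound back to step 0.\<close>
  also have "e 0 - 1 / r \<le> e j - 1 / r" using mono by simp
  also have "\<dots> \<le> 2 * x" unfolding e_def x_def by (rule venergy_le_vinfo[OF V])
  also have "2 * x \<le> 2 * ((c * (\<eta> + C / m) + (n + m) * \<kappa> + m * \<theta> * C) / (1 - c))"
    using x by (rule mult_left_mono) simp
  finally show ?thesis by (simp only: times_divide_eq_right times_divide_eq_left)
qed

end

section \<open>Asymptotics\<close>

lemma pmf_edge_obs_Some:
  fixes \<mu> \<nu> :: "'l::finite pmf"
  assumes "a > 0" "b > 0" "\<omega> > 0" "real n \<ge> \<omega>"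
  shows "pmf (edge_obs a b \<omega> n \<mu> \<nu> s) (Some l)
    = \<omega> / n * ((if s then a else b) / (a + b) * pmf (if s then \<mu> else \<nu>) l)"
proof -
  define p where "p = (if s then a / (a + b) else b / (a + b))"
  have p: "0 \<le> p" "p \<le> 1" using assms by (auto simp: p_def)
  have n: "real n > 0" using assms by linarith
  have q: "min 1 (\<omega> / n) = \<omega> / n" "0 \<le> \<omega> / n" "\<omega> / n \<le> 1" using assms n by auto
  define N where "N = (if s then \<mu> else \<nu>)"
  have 1: "pmf (bind_pmf (bernoulli_pmf (\<omega> / n)) (\<lambda>k. return_pmf (if e \<and> k then Some l' else None))) (Some l)
      = of_bool e * (\<omega> / n) * of_bool (l' = l)" for e l'
    unfolding pmf_bind integral_bernoulli_pmf[OF q(2,3)] pmf_return by (simp add: indicator_def)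
  have 2: "pmf (bind_pmf N (\<lambda>l'. bind_pmf (bernoulli_pmf (\<omega> / n))
        (\<lambda>k. return_pmf (if e \<and> k then Some l' else None)))) (Some l)
      = of_bool e * (\<omega> / n) * pmf N l" for e
  proof -
    have "pmf (bind_pmf N (\<lambda>l'. bind_pmf (bernoulli_pmf (\<omega> / n))
        (\<lambda>k. return_pmf (if e \<and> k then Some l' else None)))) (Some l)
      = expect N (\<lambda>l'. of_bool e * (\<omega> / n) * of_bool (l' = l))"
      unfolding pmf_bind[of N] 1 ..
    also have "\<dots> = (\<Sum>l'\<in>UNIV. of_bool e * (\<omega> / n) * of_bool (l' = l) * pmf N l')"
      by (rule integral_measure_pmf_real) auto
    also have "\<dots> = (\<Sum>l'\<in>UNIV. if l' = l then of_bool e * (\<omega> / n) * pmf N l' else 0)"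
      by (intro sum.cong) auto
    finally show ?thesis by simp
  qed
  have "pmf (edge_obs a b \<omega> n \<mu> \<nu> s) (Some l) = p * (\<omega> / n) * pmf N l"
    unfolding edge_obs_def p_def[symmetric] N_def[symmetric] q(1)
    unfolding pmf_bind[of "bernoulli_pmf p"] 2 integral_bernoulli_pmf[OF p] by simp
  then show ?thesis by (simp add: p_def N_def mult_ac)
qed

lemma pmf_edge_obs_None:
  fixes \<mu> \<nu> :: "'l::finite pmf"
  assumes "a > 0" "b > 0" "\<omega> > 0" "real n \<ge> \<omega>"
  shows "pmf (edge_obs a b \<omega> n \<mu> \<nu> s) None = 1 - \<omega> / n * ((if s then a else b) / (a + b))"
proof -
  define E where "E = edge_obs a b \<omega> n \<mu> \<nu> s"
  have "1 = (\<Sum>y\<in>UNIV. pmf E y)" by (simp add: sum_pmf_eq_1)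
  also have "\<dots> = pmf E None + (\<Sum>l\<in>UNIV. pmf E (Some l))"
    by (simp add: UNIV_option_conv sum.reindex)
  also have "(\<Sum>l\<in>UNIV. pmf E (Some l))
      = \<omega> / n * ((if s then a else b) / (a + b) * (\<Sum>l\<in>UNIV. pmf (if s then \<mu> else \<nu>) l))"
    unfolding E_def pmf_edge_obs_Some[OF assms] by (simp only: sum_distrib_left)
  also have "(\<Sum>l\<in>UNIV. pmf (if s then \<mu> else \<nu>) l) = 1" by (simp add: sum_pmf_eq_1)
  finally show ?thesis by (simp add: E_def)
qed

text \<open>The source of \<tau>: the two laws differ at a label l by \<omega> / (n (a + b)) times a
  \<mu>(l) - b \<nu>(l), and positive and negative parts recombine to the absolute value. The factor
  \<open>r\<close> is split off because the recursion divides by it.\<close>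

lemma edge_obs_weights:
  fixes \<mu> \<nu> :: "'l::finite pmf"
  assumes "a > 0" "b > 0" "\<omega> > 0" "real n \<ge> \<omega>" "r \<ge> 2"
  defines "P \<equiv> edge_obs a b \<omega> n \<mu> \<nu> True" and "Q \<equiv> edge_obs a b \<omega> n \<mu> \<nu> False"
  shows "(\<Sum>y\<in>UNIV - {None}. max 0 (pmf P y - pmf Q y)) + (\<Sum>y\<in>UNIV - {None}. max 0 (pmf Q y - pmf P y))
    = r * (\<omega> * tau r a b \<mu> \<nu> / n)"
proof -
  have n: "real n > 0" using assms by linarith
  have "(\<Sum>y\<in>UNIV - {None}. max 0 (pmf P y - pmf Q y)) + (\<Sum>y\<in>UNIV - {None}. max 0 (pmf Q y - pmf P y))
      = (\<Sum>y\<in>UNIV - {None}. \<bar>pmf P y - pmf Q y\<bar>)"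
    unfolding sum.distrib[symmetric] by (intro sum.cong refl) auto
  also have "\<dots> = (\<Sum>y\<in>Some ` (UNIV :: 'l set). \<bar>pmf P y - pmf Q y\<bar>)"
    by (intro sum.cong) (auto simp: UNIV_option_conv)
  also have "(\<Sum>y\<in>Some ` (UNIV :: 'l set). \<bar>pmf P y - pmf Q y\<bar>) = (\<Sum>l\<in>UNIV. \<bar>pmf P (Some l) - pmf Q (Some l)\<bar>)"
    by (simp add: sum.reindex)
  also have "\<dots> = (\<Sum>l\<in>UNIV. \<omega> / n / (a + b) * \<bar>a * pmf \<mu> l - b * pmf \<nu> l\<bar>)"
  proof (intro sum.cong refl)
    fix l
    have "pmf P (Some l) - pmf Q (Some l) = \<omega> / n / (a + b) * (a * pmf \<mu> l - b * pmf \<nu> l)"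
      unfolding P_def Q_def pmf_edge_obs_Some[OF assms(1-4)] by (simp add: right_diff_distrib)
    then show "\<bar>pmf P (Some l) - pmf Q (Some l)\<bar> = \<omega> / n / (a + b) * \<bar>a * pmf \<mu> l - b * pmf \<nu> l\<bar>"
      using assms n by (simp add: abs_mult)
  qed
  also have "\<dots> = r * (\<omega> * tau r a b \<mu> \<nu> / n)"
    unfolding sum_distrib_left[symmetric] using assms by (simp add: tau_def)
  finally show ?thesis .
qed

text \<open>Retention probability at most 1/2 keeps both probabilities of no edge, hence their
  average, at least 1/2; this is the factor 2. Their difference is at most \<omega>/n, so summing
  over n neighbours still gives O(1/n).\<close>

lemma edge_obs_None_info:
  fixes \<mu> \<nu> :: "'l::finite pmf"
  assumes "a > 0" "b > 0" "\<omega> > 0" "real n \<ge> 2 * \<omega>" "r \<ge> 2"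
  defines "P \<equiv> edge_obs a b \<omega> n \<mu> \<nu> True" and "Q \<equiv> edge_obs a b \<omega> n \<mu> \<nu> False"
  shows "(pmf P None - pmf Q None)\<^sup>2 / edge_avg r P Q None \<le> 2 * \<omega>\<^sup>2 / n\<^sup>2"
proof -
  have n: "real n > 0" "real n \<ge> \<omega>" using assms by linarith+
  have w: "0 \<le> \<omega> / n" "\<omega> / n \<le> 1/2" using assms n by (auto simp: field_simps)
  define s where "s = a / (a + b)"
  define t where "t = b / (a + b)"
  have st: "0 \<le> s" "0 \<le> t" "s \<le> 1" "t \<le> 1" using assms by (auto simp: s_def t_def)
  have PQ: "pmf P None = 1 - \<omega> / n * s" "pmf Q None = 1 - \<omega> / n * t"
    by (simp_all add: P_def Q_def pmf_edge_obs_None[OF assms(1-3) n(2)] s_def t_def)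
  have "\<omega> / n * s \<le> 1/2 * 1" "\<omega> / n * t \<le> 1/2 * 1" using w st by (intro mult_mono; simp)+
  then have half: "pmf P None \<ge> 1/2" "pmf Q None \<ge> 1/2" by (auto simp: PQ)
  have "edge_avg r P Q None = (1 - 1 / r) * pmf Q None + 1 / r * pmf P None"
    by (simp add: edge_avg_def edge_law_def algebra_simps)
  also have "\<dots> \<ge> (1 - 1 / r) * (1/2) + 1 / r * (1/2)"
    using half assms by (intro add_mono mult_left_mono) auto
  finally have avg: "edge_avg r P Q None \<ge> 1/2" by (simp add: algebra_simps)
  have "(pmf P None - pmf Q None)\<^sup>2 = (\<omega> / n)\<^sup>2 * (t - s)\<^sup>2"
    by (simp add: PQ power_mult_distrib[symmetric] right_diff_distrib)
  also have "\<dots> \<le> (\<omega> / n)\<^sup>2 * 1"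
    using st by (intro mult_left_mono) (auto simp: abs_square_le_1 abs_le_iff)
  finally have "(pmf P None - pmf Q None)\<^sup>2 / edge_avg r P Q None \<le> (\<omega> / n)\<^sup>2 / (1/2)"
    using avg by (intro frac_le) auto
  then show ?thesis by (simp add: power_divide mult.commute)
qed

section \<open>Translation to ordered pairs and to conditional probabilities\<close>

definition pair_graph :: "nat \<Rightarrow> (nat \<Rightarrow> nat) \<times> (nat set \<Rightarrow> 'l option) \<Rightarrow> nat \<times> nat \<Rightarrow> 'l option" where
  "pair_graph n w p = (if p \<in> node_pairs n then snd w {fst p, snd p} else None)"

lemma bij_betw_node_pairs: "bij_betw (\<lambda>p. {fst p, snd p}) (node_pairs n) (pairs {..<n})"
proof (rule bij_betwI')
  fix p q assume "p \<in> node_pairs n" "q \<in> node_pairs n"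
  then show "({fst p, snd p} = {fst q, snd q}) = (p = q)"
    by (auto simp: node_pairs_def doubleton_eq_iff)
next
  fix p assume "p \<in> node_pairs n"
  then show "{fst p, snd p} \<in> pairs {..<n}" by (auto simp: node_pairs_def pairs_def)
next
  fix e assume "e \<in> pairs {..<n}"
  then obtain i j where e: "e = {i, j}" "i \<noteq> j" "i < n" "j < n"
    by (auto simp: pairs_def card_2_iff)
  then show "\<exists>p\<in>node_pairs n. e = {fst p, snd p}"
    by (intro bexI[of _ "(min i j, max i j)"]) (auto simp: node_pairs_def min_def max_def)
qed

lemma finite_node_pairs: "finite (node_pairs n)"
  by (rule finite_subset[of _ "{..<n} \<times> {..<n}"]) (auto simp: node_pairs_def)

lemma pair_graph_eq_iff:
  "pair_graph n u = pair_graph n w \<longleftrightarrow> (\<forall>e\<in>pairs {..<n}. snd u e = snd w e)"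
proof -
  have "pair_graph n u = pair_graph n w
      \<longleftrightarrow> (\<forall>p\<in>node_pairs n. snd u {fst p, snd p} = snd w {fst p, snd p})"
    by (auto simp: pair_graph_def fun_eq_iff)
  also have "\<dots> \<longleftrightarrow> (\<forall>e\<in>(\<lambda>p. {fst p, snd p}) ` node_pairs n. snd u e = snd w e)" by simp
  finally show ?thesis using bij_betw_imp_surj_on[OF bij_betw_node_pairs] by simp
qed

locale lsbm_model =
  fixes r n :: nat and a b \<omega> :: real and \<mu> \<nu> :: "'l::finite pmf"
  assumes r: "r \<ge> 2"
begin

sublocale block_model r "edge_obs a b \<omega> n \<mu> \<nu> True" "edge_obs a b \<omega> n \<mu> \<nu> False" None
  using r by unfold_locales

lemma lsbm_eq_map:
  "lsbm r a b \<omega> \<mu> \<nu> n = map_pmf (\<lambda>w. (fst w, pair_graph n w)) (model {..<n})"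
proof -
  have g: "map_pmf (\<lambda>G. pair_graph n (\<sigma>, G)) (graph {..<n} \<sigma>)
      = Pi_pmf (node_pairs n) None (\<lambda>(i, j). edge_obs a b \<omega> n \<mu> \<nu> (\<sigma> i = \<sigma> j))" for \<sigma>
  proof -
    have "map_pmf (\<lambda>G. pair_graph n (\<sigma>, G)) (graph {..<n} \<sigma>)
        = map_pmf (\<lambda>G p. if p \<in> node_pairs n then G {fst p, snd p} else None) (graph {..<n} \<sigma>)"
      by (intro map_pmf_cong refl) (auto simp: pair_graph_def fun_eq_iff)
    also have "\<dots> = Pi_pmf (node_pairs n) None (kernel \<sigma> \<circ> (\<lambda>p. {fst p, snd p}))"
      unfolding graph_def by (rule Pi_pmf_reindex[OF finite_node_pairs bij_betw_node_pairs])
    also have "\<dots> = Pi_pmf (node_pairs n) None (\<lambda>(i, j). edge_obs a b \<omega> n \<mu> \<nu> (\<sigma> i = \<sigma> j))"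
      by (intro Pi_pmf_cong refl) (auto simp: kernel_pair)
    finally show ?thesis .
  qed
  have "map_pmf (\<lambda>w. (fst w, pair_graph n w)) (model {..<n})
      = bind_pmf (colours {..<n}) (\<lambda>\<sigma>. map_pmf (Pair \<sigma>) (map_pmf (\<lambda>G. pair_graph n (\<sigma>, G)) (graph {..<n} \<sigma>)))"
    by (simp add: model_def map_bind_pmf map_pmf_comp)
  then show ?thesis by (simp add: g lsbm_def colours_def)
qed

text \<open>When \<open>w\<close> gives \<open>v\<close> the colour \<open>y\<close>, the
  conditioning event is exactly the level set of the observation through \<open>w\<close>.\<close>

lemma cond_prob_eq_post:
  assumes "fst w v = y"
  shows "cond_prob r a b \<omega> \<mu> \<nu> n \<rho> v x y (pair_graph n w)
    = post (model {..<n}) (observe (pairs {..<n}) {v}) (\<lambda>u. fst u \<rho> = x) w"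
proof -
  have "measure_pmf.prob (lsbm r a b \<omega> \<mu> \<nu> n) {(\<sigma>, G). \<sigma> \<rho> = x \<and> \<sigma> v = y \<and> G = pair_graph n w}
     = measure_pmf.prob (model {..<n}) {u. fst u \<rho> = x \<and> observe (pairs {..<n}) {v} u = observe (pairs {..<n}) {v} w}"
    unfolding lsbm_eq_map measure_map_pmf
    by (rule arg_cong2[where f = measure]) (auto simp: vimage_def pair_graph_eq_iff observe_eq_iff assms)
  moreover have "measure_pmf.prob (lsbm r a b \<omega> \<mu> \<nu> n) {(\<sigma>, G). \<sigma> v = y \<and> G = pair_graph n w}
     = measure_pmf.prob (model {..<n}) {u. observe (pairs {..<n}) {v} u = observe (pairs {..<n}) {v} w}"
    unfolding lsbm_eq_map measure_map_pmf
    by (rule arg_cong2[where f = measure]) (auto simp: vimage_def pair_graph_eq_iff observe_eq_iff assms)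
  ultimately show ?thesis by (simp add: cond_prob_def post_def)
qed

text \<open>Chebyshev's inequality for the posterior. The event depends on the graph alone, whereas
  \<open>cond_prob\<close> is a posterior at \<open>w\<close> only if \<open>v\<close> has colour
  \<open>y\<close>; independence of graph and colour inserts this condition at the price of the
  factor \<open>r\<close>.\<close>

lemma prob_cond_prob_le:
  assumes \<rho>: "\<rho> < n" and v: "v < n" and x: "x \<in> {1..r}" and y: "y \<in> {1..r}" and \<epsilon>: "\<epsilon> > 0"
  shows "measure_pmf.prob (lsbm r a b \<omega> \<mu> \<nu> n)
      {(\<sigma>, G). \<bar>cond_prob r a b \<omega> \<mu> \<nu> n \<rho> v x y G - 1 / r\<bar> > \<epsilon>}
    \<le> r / \<epsilon>\<^sup>2 * (venergy {..<n} (pairs {..<n}) {v} \<rho> - 1 / r)"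
proof -
  define M where "M = model {..<n}"
  have fin: "finite (set_pmf M)" unfolding M_def by (rule finite_set_model) simp
  define H where "H = (\<lambda>w. \<bar>cond_prob r a b \<omega> \<mu> \<nu> n \<rho> v x y (pair_graph n w) - 1 / r\<bar> > \<epsilon>)"
  define q where "q = (\<lambda>x. post M (observe (pairs {..<n}) {v}) (\<lambda>u. fst u \<rho> = x))"
  \<comment> \<open>An arbitrary colouring is substituted to express that \<open>H\<close> depends
    on the graph alone.\<close>
  have "pair_graph n (undefined, snd w) = pair_graph n w" for w :: "(nat \<Rightarrow> nat) \<times> (nat set \<Rightarrow> 'l option)"
    by (simp add: pair_graph_def fun_eq_iff)
  then have H: "H w = H (undefined, snd w)" for w by (simp add: H_def)
  have "measure_pmf.prob (lsbm r a b \<omega> \<mu> \<nu> n)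
      {(\<sigma>, G). \<bar>cond_prob r a b \<omega> \<mu> \<nu> n \<rho> v x y G - 1 / r\<bar> > \<epsilon>}
    = measure_pmf.prob M {w. H w}"
    unfolding lsbm_eq_map measure_map_pmf H_def M_def by (simp add: vimage_def)
  also have "\<dots> = r * measure_pmf.prob M {w. fst w v = y \<and> H w}"
    using prob_colour_graph[of "{..<n}" v y "\<lambda>G. H (undefined, G)"] v y r
    by (simp add: M_def H[symmetric])
  also have "measure_pmf.prob M {w. fst w v = y \<and> H w} = expect M (\<lambda>w. of_bool (fst w v = y \<and> H w))"
    by (simp add: expect_finite[OF fin] prob_finite[OF fin])
  also have "\<dots> \<le> expect M (\<lambda>w. (q x w - 1 / r)\<^sup>2 / \<epsilon>\<^sup>2)"
  proof (rule expect_mono[OF fin])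
    fix w
    show "of_bool (fst w v = y \<and> H w) \<le> (q x w - 1 / r)\<^sup>2 / \<epsilon>\<^sup>2"
    proof (cases "fst w v = y \<and> H w")
      case True
      then have "\<epsilon> < \<bar>q x w - 1 / r\<bar>"
        using cond_prob_eq_post[of w v y \<rho> x] by (simp add: H_def q_def M_def)
      then have "\<epsilon>\<^sup>2 \<le> (q x w - 1 / r)\<^sup>2"
        using \<epsilon> power_mono[of \<epsilon> "\<bar>q x w - 1 / r\<bar>" 2] by simp
      then show ?thesis using True \<epsilon> by simp
    qed auto
  qed
  also have "\<dots> = expect M (\<lambda>w. (q x w - 1 / r)\<^sup>2) / \<epsilon>\<^sup>2" by simp
  also have "expect M (\<lambda>w. (q x w - 1 / r)\<^sup>2) \<le> (\<Sum>x\<in>{1..r}. expect M (\<lambda>w. (q x w - 1 / r)\<^sup>2))"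
    using x by (intro member_le_sum[of _ _ "\<lambda>x. expect M (\<lambda>w. (q x w - 1 / r)\<^sup>2)"] integral_nonneg) auto
  also have "\<dots> = venergy {..<n} (pairs {..<n}) {v} \<rho> - 1 / r"
    unfolding q_def M_def using \<rho> by (intro sum_expect_centered_eq_venergy) auto
  finally show ?thesis using r by (simp add: divide_right_mono mult_left_mono)
qed

text \<open>Exchangeability gives every ordered pair of distinct vertices the energy of the pair
  \<open>0\<close>, \<open>n - 1\<close>, so averaging over the random pair costs nothing.\<close>

lemma prob_pair_le:
  assumes n: "n \<ge> 2" and x: "x \<in> {1..r}" and y: "y \<in> {1..r}" and \<epsilon>: "\<epsilon> > 0"
  shows "measure_pmf.prob
            (pair_pmf (pmf_of_set {(\<rho>, v). \<rho> < n \<and> v < n \<and> \<rho> \<noteq> v}) (lsbm r a b \<omega> \<mu> \<nu> n))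
            {((\<rho>, v), (\<sigma>, G)). \<bar>cond_prob r a b \<omega> \<mu> \<nu> n \<rho> v x y G - 1 / real r\<bar> > \<epsilon>}
    \<le> r / \<epsilon>\<^sup>2 * (venergy {..<n} (pairs {..<n}) {n - 1} 0 - 1 / r)" (is "?lhs \<le> ?B")
proof -
  define U where "U = pmf_of_set {(\<rho>, v). \<rho> < n \<and> v < n \<and> \<rho> \<noteq> v}"
  define L where "L = lsbm r a b \<omega> \<mu> \<nu> n"
  define H where "H = (\<lambda>p G. \<bar>cond_prob r a b \<omega> \<mu> \<nu> n (fst p) (snd p) x y G - 1 / real r\<bar> > \<epsilon>)"
  have finS: "finite {(\<rho>, v). \<rho> < n \<and> v < n \<and> \<rho> \<noteq> v}"
    by (rule finite_subset[of _ "{..<n} \<times> {..<n}"]) auto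
  have neS: "{(\<rho>, v). \<rho> < n \<and> v < n \<and> \<rho> \<noteq> v} \<noteq> {}"
  proof -
    have "(0, 1) \<in> {(\<rho>, v). \<rho> < n \<and> v < n \<and> \<rho> \<noteq> v}" using n by simp
    then show ?thesis by blast
  qed
  have setU: "set_pmf U = {(\<rho>, v). \<rho> < n \<and> v < n \<and> \<rho> \<noteq> v}" unfolding U_def by (rule set_pmf_of_set[OF neS finS])
  have finU: "finite (set_pmf U)" using setU finS by simp
  have finL: "finite (set_pmf L)" by (simp add: L_def lsbm_eq_map finite_set_model)
  have "?lhs = measure_pmf.prob (pair_pmf U L) {z. H (fst z) (snd (snd z))}"
    unfolding U_def L_def H_def by (rule arg_cong2[where f = measure]) auto
  also have "\<dots> = (\<Sum>z\<in>set_pmf U \<times> set_pmf L. of_bool (H (fst z) (snd (snd z))) * (pmf U (fst z) * pmf L (snd z)))"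
    by (subst prob_finite) (auto simp: finU finL pmf_pair intro!: sum.cong)
  also have "\<dots> = (\<Sum>p\<in>set_pmf U. pmf U p * measure_pmf.prob L {w. H p (snd w)})"
    by (simp add: sum.cartesian_product prob_finite[OF finL] sum_distrib_left case_prod_unfold mult_ac)
  also have "\<dots> \<le> (\<Sum>p\<in>set_pmf U. pmf U p * ?B)"
  proof (intro sum_mono mult_left_mono)
    fix p assume "p \<in> set_pmf U"
    then obtain \<rho> v where p: "p = (\<rho>, v)" "\<rho> < n" "v < n" "\<rho> \<noteq> v" by (auto simp: setU)
    have "measure_pmf.prob L {w. H p (snd w)}
        = measure_pmf.prob L {(\<sigma>, G). \<bar>cond_prob r a b \<omega> \<mu> \<nu> n \<rho> v x y G - 1 / r\<bar> > \<epsilon>}"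
      by (rule arg_cong2[where f = measure]) (auto simp: H_def p)
    also have "\<dots> \<le> r / \<epsilon>\<^sup>2 * (venergy {..<n} (pairs {..<n}) {v} \<rho> - 1 / r)"
      unfolding L_def by (rule prob_cond_prob_le[OF p(2,3) x y \<epsilon>])
    also have "venergy {..<n} (pairs {..<n}) {v} \<rho> = venergy {..<n} (pairs {..<n}) {n - 1} 0"
      using p n by (intro venergy_pair_exchange) auto
    finally show "measure_pmf.prob L {w. H p (snd w)} \<le> ?B" .
  qed simp
  also have "\<dots> = ?B" unfolding sum_distrib_right[symmetric] by (simp add: sum_pmf_eq_1[OF finU])
  finally show ?thesis .
qed

end

section \<open>Choice of the constants and the limit\<close>

lemma psi_modulus:
  assumes "r \<ge> 2" "\<eta> > 0"
  obtains C where "C \<ge> 0"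
    "\<And>p q. p \<in> {0..1} \<Longrightarrow> q \<in> {0..1} \<Longrightarrow> psi_eq r p \<le> psi_eq r q + \<eta> + C * (p - q)\<^sup>2"
    "\<And>p. p \<in> {0..1} \<Longrightarrow> psi_eq r p \<le> C"
    "\<And>p q. p \<in> {0..1} \<Longrightarrow> q \<in> {0..1} \<Longrightarrow> psi_neq r p \<le> psi_neq r q + \<eta> + C * (p - q)\<^sup>2"
    "\<And>p. p \<in> {0..1} \<Longrightarrow> psi_neq r p \<le> C"
proof -
  obtain C1 where C1: "C1 \<ge> 0"
    "\<And>p q. p \<in> {0..1} \<Longrightarrow> q \<in> {0..1} \<Longrightarrow> psi_eq r p \<le> psi_eq r q + \<eta> + C1 * (p - q)\<^sup>2"
    "\<And>p. p \<in> {0..1} \<Longrightarrow> psi_eq r p \<le> C1"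
    using continuous_modulus_quadratic[OF continuous_on_psi_eq assms(2)] by metis
  obtain C2 where C2: "C2 \<ge> 0"
    "\<And>p q. p \<in> {0..1} \<Longrightarrow> q \<in> {0..1} \<Longrightarrow> psi_neq r p \<le> psi_neq r q + \<eta> + C2 * (p - q)\<^sup>2"
    "\<And>p. p \<in> {0..1} \<Longrightarrow> psi_neq r p \<le> C2"
    using continuous_modulus_quadratic[OF continuous_on_psi_neq[OF assms(1)] assms(2)] by metis
  define C where "C = C1 + C2"
  have le: "C1 * z\<^sup>2 \<le> C * z\<^sup>2" "C2 * z\<^sup>2 \<le> C * z\<^sup>2" "C1 \<le> C" "C2 \<le> C" for z :: real
    using C1(1) C2(1) by (auto simp: C_def intro: mult_right_mono)
  show ?thesis
  proof (rule that[of C])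
    show "C \<ge> 0" using C1(1) C2(1) by (simp add: C_def)
  next
    fix p q :: real assume "p \<in> {0..1}" "q \<in> {0..1}"
    then show "psi_eq r p \<le> psi_eq r q + \<eta> + C * (p - q)\<^sup>2"
      "psi_neq r p \<le> psi_neq r q + \<eta> + C * (p - q)\<^sup>2"
      using C1(2)[of p q] C2(2)[of p q] le(1,2)[of "p - q"] by linarith+
  next
    fix p :: real assume "p \<in> {0..1}"
    then show "psi_eq r p \<le> C" "psi_neq r p \<le> C"
      using C1(3)[of p] C2(3)[of p] le(3,4) by linarith+
  qed
qed

lemma prob_pair_bound:
  fixes r n m :: nat and a b \<omega> \<epsilon> :: real and \<mu> \<nu> :: "'l::finite pmf" and x y :: nat
  assumes r: "r \<ge> 2" and ab: "a > 0" "b > 0" "\<omega> > 0" and c: "\<omega> * tau r a b \<mu> \<nu> = c" "c < 1"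
    and xy: "x \<in> {1..r}" "y \<in> {1..r}" "\<epsilon> > 0"
    and n: "n \<ge> 2" "real n \<ge> 2 * \<omega>" and m: "m \<ge> 1"
    and mod: "\<eta> > 0" "C \<ge> 0"
    "\<And>p q. p \<in> {0..1} \<Longrightarrow> q \<in> {0..1} \<Longrightarrow> psi_eq r p \<le> psi_eq r q + \<eta> + C * (p - q)\<^sup>2"
    "\<And>p. p \<in> {0..1} \<Longrightarrow> psi_eq r p \<le> C"
    "\<And>p q. p \<in> {0..1} \<Longrightarrow> q \<in> {0..1} \<Longrightarrow> psi_neq r p \<le> psi_neq r q + \<eta> + C * (p - q)\<^sup>2"
    "\<And>p. p \<in> {0..1} \<Longrightarrow> psi_neq r p \<le> C"
  shows "measure_pmf.prob
            (pair_pmf (pmf_of_set {(\<rho>, v). \<rho> < n \<and> v < n \<and> \<rho> \<noteq> v}) (lsbm r a b \<omega> \<mu> \<nu> n))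
            {((\<rho>, v), (\<sigma>, G)). \<bar>cond_prob r a b \<omega> \<mu> \<nu> n \<rho> v x y G - 1 / real r\<bar> > \<epsilon>}
    \<le> r / \<epsilon>\<^sup>2 * (2 / (1 - c) * (c * (\<eta> + C / m) + (n + m) * (2 * \<omega>\<^sup>2 / n\<^sup>2) + m * (c / n) * C))"
proof -
  interpret lsbm_model r n a b \<omega> \<mu> \<nu> using r by unfold_locales
  define P where "P = edge_obs a b \<omega> n \<mu> \<nu> True"
  define Q where "Q = edge_obs a b \<omega> n \<mu> \<nu> False"
  define \<alpha> where "\<alpha> = (\<Sum>y\<in>UNIV - {None}. max 0 (pmf P y - pmf Q y))"
  define \<beta> where "\<beta> = (\<Sum>y\<in>UNIV - {None}. max 0 (pmf Q y - pmf P y))"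
  have n': "real n \<ge> \<omega>" "real n > 0" using n ab by linarith+
  have \<alpha>\<beta>: "(\<alpha> + \<beta>) / r = c / n"
    using edge_obs_weights[OF ab n'(1) r, of \<mu> \<nu>] c(1) r by (simp add: \<alpha>_def \<beta>_def P_def Q_def)
  interpret block_model_bound r "edge_obs a b \<omega> n \<mu> \<nu> True" "edge_obs a b \<omega> n \<mu> \<nu> False" None
    \<alpha> \<beta> "2 * \<omega>\<^sup>2 / n\<^sup>2" \<eta> C
  proof unfold_locales
    show "0 \<le> \<alpha>" "0 \<le> \<beta>" by (auto simp: \<alpha>_def \<beta>_def intro!: sum_nonneg)
    show "edge_kl r (edge_obs a b \<omega> n \<mu> \<nu> True) (edge_obs a b \<omega> n \<mu> \<nu> False) p
        \<le> (\<alpha> * psi_eq r p + \<beta> * psi_neq r p) / r + 2 * \<omega>\<^sup>2 / n\<^sup>2" if "0 \<le> p" "p \<le> 1" for p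
      using edge_kl_le[OF r that, of P Q None] edge_obs_None_info[OF ab n(2) r, of \<mu> \<nu>]
      unfolding \<alpha>_def \<beta>_def P_def Q_def by linarith
  qed (use mod in auto)
  have \<theta>: "\<theta> = c / n" using \<alpha>\<beta> by (simp add: \<theta>_def)
  have "venergy {..<n} (pairs {..<n}) {n - 1} 0 - 1 / r
      \<le> 2 / (1 - c) * (c * (\<eta> + C / m) + (n + m) * (2 * \<omega>\<^sup>2 / n\<^sup>2) + m * (c / n) * C)"
    using venergy_bound[OF n(1) m _ c(2)] n' unfolding \<theta> by simp
  then have "r / \<epsilon>\<^sup>2 * (venergy {..<n} (pairs {..<n}) {n - 1} 0 - 1 / r)
      \<le> r / \<epsilon>\<^sup>2 * (2 / (1 - c) * (c * (\<eta> + C / m) + (n + m) * (2 * \<omega>\<^sup>2 / n\<^sup>2) + m * (c / n) * C))"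
    by (intro mult_left_mono) auto
  then show ?thesis using prob_pair_le[OF n(1) xy] by linarith
qed

theorem theorem2:
  fixes r :: nat and a b \<omega> \<epsilon> :: real and \<mu> \<nu> :: "'l::finite pmf" and x y :: nat
  assumes "r \<ge> 2" and "a > 0" and "b > 0" and "\<omega> > 0" and "\<mu> \<noteq> \<nu>"
    and "\<omega> < 1 / tau r a b \<mu> \<nu>"
    and "x \<in> {1..r}" and "y \<in> {1..r}" and "\<epsilon> > 0"
  shows "(\<lambda>n. measure_pmf.prob
            (pair_pmf (pmf_of_set {(\<rho>, v). \<rho> < n \<and> v < n \<and> \<rho> \<noteq> v}) (lsbm r a b \<omega> \<mu> \<nu> n))
            {((\<rho>, v), (\<sigma>, G)). \<bar>cond_prob r a b \<omega> \<mu> \<nu> n \<rho> v x y G - 1 / real r\<bar> > \<epsilon>})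
         \<longlonglongrightarrow> 0"
proof -
  define c where "c = \<omega> * tau r a b \<mu> \<nu>"
  have tau0: "tau r a b \<mu> \<nu> \<ge> 0" using assms by (auto simp: tau_def intro!: sum_nonneg divide_nonneg_nonneg)
  have c: "0 \<le> c" "c < 1"
  proof -
    show "c < 1"
    \<comment> \<open>For \<open>tau = 0\<close> the threshold inequality cannot be multiplied out,
      but then \<open>c = 0\<close>.\<close>
    proof (cases "tau r a b \<mu> \<nu> = 0")
      case False
      then show ?thesis using assms(6) tau0 by (simp add: c_def pos_less_divide_eq)
    qed (simp add: c_def)
  qed (use tau0 assms in \<open>simp add: c_def\<close>)
  define D where "D = r / \<epsilon>\<^sup>2 * (2 / (1 - c))"
  have D: "D > 0" using assms c by (simp add: D_def)
  show ?thesis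
  proof (rule order_tendstoI)
    fix \<delta> :: real assume \<delta>: "0 < \<delta>"
    \<comment> \<open>The bound tends to \<open>D * (c * (\<eta> + C / m))\<close>. With
      \<open>C / m\<close> at most \<eta> and \<open>c\<close> below 1 this is at most
      \<open>2 * D * \<eta>\<close>, half of \<delta>.\<close>
    define \<eta> where "\<eta> = \<delta> / (4 * D)"
    have \<eta>: "\<eta> > 0" using \<delta> D by (simp add: \<eta>_def)
    obtain C where C: "C \<ge> 0"
      "\<And>p q. p \<in> {0..1} \<Longrightarrow> q \<in> {0..1} \<Longrightarrow> psi_eq r p \<le> psi_eq r q + \<eta> + C * (p - q)\<^sup>2"
      "\<And>p. p \<in> {0..1} \<Longrightarrow> psi_eq r p \<le> C"
      "\<And>p q. p \<in> {0..1} \<Longrightarrow> q \<in> {0..1} \<Longrightarrow> psi_neq r p \<le> psi_neq r q + \<eta> + C * (p - q)\<^sup>2"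
      "\<And>p. p \<in> {0..1} \<Longrightarrow> psi_neq r p \<le> C"
      using psi_modulus[OF assms(1) \<eta>] by metis
    \<comment> \<open>\<open>m\<close> depends on \<open>C\<close>, hence on \<delta>, but not on n,
      so the terms proportional to m / n vanish in the limit.\<close>
    obtain m :: nat where m: "m \<ge> 1" "C / m \<le> \<eta>"
    proof -
      obtain k :: nat where k: "C / \<eta> \<le> k" using real_arch_simple by blast
      have "C / real (k + 1) \<le> \<eta>"
        using k \<eta> C(1) by (simp add: divide_le_eq mult.commute) (smt (verit) mult_left_mono)
      then show ?thesis using that[of "k + 1"] by simp
    qed
    define bound where "bound = (\<lambda>n::nat. r / \<epsilon>\<^sup>2 * (2 / (1 - c)
      * (c * (\<eta> + C / m) + (n + m) * (2 * \<omega>\<^sup>2 / n\<^sup>2) + m * (c / n) * C)))"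
    have "(\<lambda>n::nat. (real n + m) * (2 * \<omega>\<^sup>2 / n\<^sup>2)) \<longlonglongrightarrow> 0" "(\<lambda>n::nat. m * (c / n) * C) \<longlonglongrightarrow> 0"
      by real_asymp+
    then have "bound \<longlonglongrightarrow> r / \<epsilon>\<^sup>2 * (2 / (1 - c) * (c * (\<eta> + C / m) + 0 + 0))"
      unfolding bound_def of_nat_add by (intro tendsto_intros)
    moreover have "r / \<epsilon>\<^sup>2 * (2 / (1 - c) * (c * (\<eta> + C / m) + 0 + 0)) < \<delta>"
    proof -
      have "c * (\<eta> + C / m) \<le> 1 * (\<eta> + \<eta>)" using c \<eta> m C(1) by (intro mult_mono) auto
      then have "D * (c * (\<eta> + C / m)) \<le> D * (2 * \<eta>)" using D by (intro mult_left_mono) auto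
      also have "\<dots> = \<delta> / 2" using D by (simp add: \<eta>_def)
      finally have "D * (c * (\<eta> + C / m)) < \<delta>" using \<delta> by linarith
      then show ?thesis by (simp only: D_def add_0_right mult.assoc)
    qed
    ultimately have "eventually (\<lambda>n. bound n < \<delta>) sequentially" by (rule order_tendstoD)
    moreover have "eventually (\<lambda>n. n \<ge> max 2 (nat \<lceil>2 * \<omega>\<rceil>)) sequentially" by (rule eventually_ge_at_top)
    ultimately show "eventually (\<lambda>n. measure_pmf.prob
            (pair_pmf (pmf_of_set {(\<rho>, v). \<rho> < n \<and> v < n \<and> \<rho> \<noteq> v}) (lsbm r a b \<omega> \<mu> \<nu> n))
            {((\<rho>, v), (\<sigma>, G)). \<bar>cond_prob r a b \<omega> \<mu> \<nu> n \<rho> v x y G - 1 / real r\<bar> > \<epsilon>} < \<delta>) sequentially"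
    proof eventually_elim
      case (elim n)
      have n: "n \<ge> 2" "real n \<ge> 2 * \<omega>" using elim(2) by linarith+
      show ?case
        using prob_pair_bound[OF assms(1-4) c_def[symmetric] c(2) assms(7-9) n m(1) \<eta> C] elim(1)
        unfolding bound_def by linarith
    qed
  qed (rule always_eventually, rule allI, erule less_le_trans, rule measure_nonneg)
qed

end
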